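(* Let $A$ be a group, $H\leq A$ a subgroup, and let $G:=A\ast_H A$ be the double of $A$ along $H$. Let $\mathcal{C}$ be a class of groups that contains a root class $\mathcal{R}$. Suppose that (1) $\mathcal{C}$ is closed under subgroups and finite direct products; (2) every $\mathcal{R}$-by-$\mathcal{C}$ group belongs to $\mathcal{C}$; (3) for every group in $\mathcal{C}$ there is a group in $\mathcal{R}$ of the same cardinality. Then $G$ is residually $\mathcal{C}$ if and only if $A$ is residually $\mathcal{C}$ and $H$ is closed in the pro-$\mathcal{C}$ topology of $A$.
   Context: The double $A\ast_H A$ is the amalgamated free product of two copies of $A$ in which the two copies of $H$ are identified via the identity map. A class of groups is a family of groups closed under isomorphism. A group $G$ is residually $\mathcal{C}$ if for every $g\in G\setminus\{e\}$ there exist $C\in\mathcal{C}$ and a surjective homomorphism $\varphi\colon G\to C$ with $\varphi(g)\neq e$. A root class is a non-trivial class $\mathcal{R}$ closed under subgroups and finite direct products satisfying the Gruenberg condition: for any chain $K\trianglelefteq H\trianglelefteq G$ with $G/H, H/K\in\mathcal{R}$ there is $L\trianglelefteq G$ with $L\subseteq K$ and $G/L\in\mathcal{R}$. A group is $\mathcal{A}$-by-$\mathcal{B}$ if it has a normal subgroup in $\mathcal{A}$ with quotient in $\mathcal{B}$. The pro-$\mathcal{C}$ topology on $A$ is the group topology having as a basis of neighbourhoods of the identity the family $\{N\trianglelefteq A\mid A/N\in\mathcal{C}\}$; a subgroup $H$ is closed in it iff for every $a\in A\setminus H$ there is a surjection $\varphi\colon A\to C\in\mathcal{C}$ with $\varphi(a)\notin\varphi(H)$.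 *)

theory Defs
  imports "HOL-Analysis.Analysis" "HOL-Algebra.Algebra"
begin

text \<open>Classes of groups. A class is represented by a predicate on groups whose
carrier lives in a fixed (arbitrary) type 'c; a group of any other type is a
member iff it is isomorphic to a member.\<close>

definition in_cls :: "('c monoid \<Rightarrow> bool) \<Rightarrow> ('b, 'm) monoid_scheme \<Rightarrow> bool" where
  "in_cls C Gx \<longleftrightarrow> group Gx \<and> (\<exists>Gy::'c monoid. C Gy \<and> is_iso Gx Gy)"

definition group_class :: "('c monoid \<Rightarrow> bool) \<Rightarrow> bool" where
  "group_class C \<longleftrightarrow> (\<forall>Gx. C Gx \<longrightarrow> group Gx) \<and>
     (\<forall>Gx Gy. C Gx \<and> group Gy \<and> is_iso Gx Gy \<longrightarrow> C Gy)"

definition closed_subgroups :: "('c monoid \<Rightarrow> bool) \<Rightarrow> bool" where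
  "closed_subgroups C \<longleftrightarrow> (\<forall>Gx S. C Gx \<and> subgroup S Gx \<longrightarrow> in_cls C (Gx\<lparr>carrier := S\<rparr>))"

definition closed_dirprod :: "('c monoid \<Rightarrow> bool) \<Rightarrow> bool" where
  "closed_dirprod C \<longleftrightarrow> (\<forall>Gx Gy. C Gx \<and> C Gy \<longrightarrow> in_cls C (Gx \<times>\<times> Gy))"

definition gruenberg :: "('c monoid \<Rightarrow> bool) \<Rightarrow> bool" where
  "gruenberg R \<longleftrightarrow> (\<forall>(G::'c monoid) H K.
     group G \<and> normal H G \<and> normal K (G\<lparr>carrier := H\<rparr>) \<and>
     in_cls R (G Mod H) \<and> in_cls R ((G\<lparr>carrier := H\<rparr>) Mod K) \<longrightarrow>
     (\<exists>L. normal L G \<and> L \<subseteq> K \<and> in_cls R (G Mod L)))"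

definition root_class :: "('c monoid \<Rightarrow> bool) \<Rightarrow> bool" where
  "root_class R \<longleftrightarrow> group_class R \<and> (\<exists>Gx. R Gx \<and> carrier Gx \<noteq> {\<one>\<^bsub>Gx\<^esub>}) \<and>
     closed_subgroups R \<and> closed_dirprod R \<and> gruenberg R"

definition closed_ext :: "('c monoid \<Rightarrow> bool) \<Rightarrow> ('c monoid \<Rightarrow> bool) \<Rightarrow> bool" where
  "closed_ext R C \<longleftrightarrow> (\<forall>(E::'c monoid) N. group E \<and> normal N E \<and>
     in_cls R (E\<lparr>carrier := N\<rparr>) \<and> in_cls C (E Mod N) \<longrightarrow> C E)"

definition residually :: "('c monoid \<Rightarrow> bool) \<Rightarrow> ('g, 'm) monoid_scheme \<Rightarrow> bool" where
  "residually C G \<longleftrightarrow> (\<forall>g\<in>carrier G. g \<noteq> \<one>\<^bsub>G\<^esub> \<longrightarrow>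
     (\<exists>(Gx::'c monoid) \<phi>. C Gx \<and> \<phi> \<in> hom G Gx \<and> \<phi> ` carrier G = carrier Gx \<and> \<phi> g \<noteq> \<one>\<^bsub>Gx\<^esub>))"

definition pro_top :: "('c monoid \<Rightarrow> bool) \<Rightarrow> ('a, 'm) monoid_scheme \<Rightarrow> 'a topology" where
  "pro_top C A = topology (\<lambda>U. U \<subseteq> carrier A \<and>
     (\<forall>x\<in>U. \<exists>N. normal N A \<and> in_cls C (A Mod N) \<and> x <#\<^bsub>A\<^esub> N \<subseteq> U))"

text \<open>G with i1, i2 is the double A *_H A, characterised (up to isomorphism) by
the universal property of the pushout of two copies of A along the identity
on H. Test groups K range over a carrier type of cardinality at least
max(aleph0, |carrier A|), large enough to contain a copy of the amalgamated
product; generation by the images gives uniqueness of the induced maps.\<close>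
definition is_double ::
  "('a, 'm) monoid_scheme \<Rightarrow> 'a set \<Rightarrow> ('g, 'n) monoid_scheme \<Rightarrow> ('a \<Rightarrow> 'g) \<Rightarrow> ('a \<Rightarrow> 'g) \<Rightarrow> bool" where
  "is_double A H G i1 i2 \<longleftrightarrow> group G \<and> i1 \<in> hom A G \<and> i2 \<in> hom A G \<and>
     (\<forall>h\<in>H. i1 h = i2 h) \<and>
     generate G (i1 ` carrier A \<union> i2 ` carrier A) = carrier G \<and>
     (\<forall>(K::(('a \<times> bool) list) monoid) f1 f2.
        group K \<and> f1 \<in> hom A K \<and> f2 \<in> hom A K \<and> (\<forall>h\<in>H. f1 h = f2 h) \<longrightarrow>
        (\<exists>\<phi>\<in>hom G K. \<forall>a\<in>carrier A. \<phi> (i1 a) = f1 a \<and> \<phi> (i2 a) = f2 a))"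

end

theory Submission
  imports Defs
begin

text \<open>Let \<open>W = U\<^sup>T \<rtimes> T\<close> be an unrestricted wreath product. Given \<open>\<phi> : A \<rightarrow> T\<close> and a function
\<open>f : T \<rightarrow> U\<close> constant on the cosets of \<open>\<phi>(H)\<close>, the map \<open>\<phi>\<close> into the top group and its conjugate by \<open>f\<close>
agree on \<open>H\<close>, hence define a homomorphism from the double to \<open>W\<close>. It separates the two copies
of an element outside \<open>H\<close>, which gives closedness of \<open>H\<close>. Conversely, an element \<open>g \<noteq> 1\<close> killed by
the folding map is an alternating word in elements outside \<open>H\<close>; closedness of \<open>H\<close> provides
\<open>\<phi>\<close> onto a group \<open>T\<close> of \<open>C\<close> keeping them outside \<open>\<phi>(H)\<close>, and \<open>g\<close> maps to a tuple of reduced words in the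
values of \<open>f\<close>. Such a word is nontrivial for suitable \<open>U\<close> in the root class \<open>R\<close>, because free groups are
residually \<open>R\<close>: iterated wreath products with a fixed nontrivial group of \<open>R\<close> remove
the coincidences among the prefixes of a word one by one.

The image of the double in \<open>W\<close> is an extension of a group \<open>N \<le> U\<^sup>T\<close> by \<open>T\<close>. With \<open>S\<close> in \<open>R\<close> of the same
cardinality as \<open>T\<close>, \<open>N\<close> embeds in \<open>U\<^sup>S \<rtimes> S\<close>, and the Gruenberg condition for the chain
\<open>{F. F(1) = 1} \<unlhd> U\<^sup>S \<unlhd> U\<^sup>S \<rtimes> S\<close> only leaves the trivial normal subgroup. As the classes consist of groups
over a fixed type \<open>'c\<close>, which may be too small for \<open>U\<^sup>S \<rtimes> S\<close>, this argument is applied to the subgroup generated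
by \<open>S\<close> and \<open>N\<close>.\<close>

section \<open>Classes of groups\<close>

text \<open>The closure conditions and the universal property of the double only speak of groups
  over one fixed carrier type. Transport of structure along an injection \<open>g\<close> brings a
  small enough group of another type within their reach.\<close>

lemma group_copy:
  fixes g :: "'a \<Rightarrow> 'b"
  assumes "group G" "inj_on g (carrier G)"
  obtains G' :: "'b monoid" where "group G'" "g \<in> iso G G'" "carrier G' = g ` carrier G"
proof -
  interpret group G by fact
  define G' where "G' = image_group g G"
  have hom: "g \<in> hom G G'"
    using assms(2) by (auto simp: G'_def image_group_def hom_def)
  have car: "carrier G' = g ` carrier G"
    by (simp add: G'_def image_group_def)
  have iso: "g \<in> iso G G'"
    using hom car assms(2) by (auto simp: Group.iso_iff)
  have "monoid G'"
    using hom_imp_img_monoid[OF hom] by (simp add: G'_def image_group_def)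
  then have "group G'"
    using iso_imp_group[of G'] iso by (auto simp: is_iso_def)
  with iso car show ?thesis using that by blast
qed

lemma in_cls_E:
  assumes "in_cls C E"
  obtains Y h where "C Y" "h \<in> iso E Y"
  using assms that unfolding in_cls_def is_iso_def by blast

lemma group_classD: "group_class C \<Longrightarrow> C T \<Longrightarrow> group T"
  unfolding group_class_def by blast

lemma in_cls_self: "group_class C \<Longrightarrow> C T \<Longrightarrow> in_cls C T"
  unfolding in_cls_def using group_classD[of C T] iso_refl[of T] by blast

text \<open>The image of \<open>E\<close> in a representative of \<open>T\<close> over
  \<open>'c\<close> is a subgroup there, and it is isomorphic to \<open>E\<close>.\<close>

lemma in_cls_inj:
  assumes "group_class C" "closed_subgroups C" "in_cls C T" "group E" "h \<in> hom E T"
    "inj_on h (carrier E)"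
  shows "in_cls C E"
proof -
  interpret E: group E by fact
  obtain Y k where Y: "C Y" "k \<in> iso T Y" using assms(3) by (rule in_cls_E)
  have gY: "group Y" using assms(1) Y(1) by (rule group_classD)
  have kh: "k \<circ> h \<in> hom E Y"
    using assms(5) Y(2) by (auto intro!: Group.hom_compose simp: iso_imp_homomorphism)
  have inj: "inj_on (k \<circ> h) (carrier E)"
    using assms(5,6) Y(2) by (auto simp: Group.iso_iff hom_def intro!: comp_inj_on elim: inj_on_subset)
  interpret kh: group_hom E Y "k \<circ> h"
    using kh gY by (simp add: group_hom_def group_hom_axioms_def E.is_group)
  let ?S = "(k \<circ> h) ` carrier E"
  have "in_cls C (Y\<lparr>carrier := ?S\<rparr>)"
    using assms(2) Y(1) kh.img_is_subgroup by (auto simp: closed_subgroups_def)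
  moreover have "E \<cong> Y\<lparr>carrier := ?S\<rparr>"
    by (rule is_isoI[of "k \<circ> h"]) (use kh inj in \<open>auto simp: Group.iso_iff hom_def\<close>)
  ultimately show ?thesis
    using assms(4) unfolding in_cls_def by (metis iso_trans)
qed

lemma in_cls_quotient:
  assumes "group_class C" "closed_subgroups C" "in_cls C T" "group G" "h \<in> hom G T"
  shows "in_cls C (G Mod kernel G T h)"
proof -
  have "group T" using assms(3) by (auto simp: in_cls_def)
  then interpret group_hom G T h
    using assms by (simp add: group_hom_def group_hom_axioms_def)
  show ?thesis
  proof (rule in_cls_inj[OF assms(1-3)])
    show "group (G Mod kernel G T h)"
      by (simp add: normal.factorgroup_is_group normal_kernel)
  qed (use FactGroup_hom FactGroup_inj_on in auto)
qed

lemma in_cls_DirProd: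
  assumes "group_class C" "closed_subgroups C" "closed_dirprod C" "in_cls C T" "in_cls C Y"
  shows "in_cls C (T \<times>\<times> Y)"
proof -
  obtain T' h where T: "C T'" "h \<in> iso T T'" using assms(4) by (rule in_cls_E)
  obtain Y' k where Y: "C Y'" "k \<in> iso Y Y'" using assms(5) by (rule in_cls_E)
  have g: "group T" "group Y" using assms(4,5) by (auto simp: in_cls_def)
  have "(\<lambda>(x, y). (h x, k y)) \<in> iso (T \<times>\<times> Y) (T' \<times>\<times> Y')"
    using group.DirProd_iso_set_trans[OF g(1) T(2) Y(2)] .
  then have "(\<lambda>(x, y). (h x, k y)) \<in> hom (T \<times>\<times> Y) (T' \<times>\<times> Y')"
    "inj_on (\<lambda>(x, y). (h x, k y)) (carrier (T \<times>\<times> Y))"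
    by (auto simp: Group.iso_iff)
  moreover have "in_cls C (T' \<times>\<times> Y')"
    using assms(3) T(1) Y(1) by (auto simp: closed_dirprod_def)
  ultimately show ?thesis
    by (rule in_cls_inj[OF assms(1,2) _ DirProd_group[OF g], rotated])
qed

text \<open>Cutting the target down to the image, which stays in the class as a subgroup, makes any
  homomorphism surjective.\<close>

lemma residually_iff:
  assumes "group_class C" "closed_subgroups C" "group G"
  shows "residually C G \<longleftrightarrow> (\<forall>g\<in>carrier G. g \<noteq> \<one>\<^bsub>G\<^esub> \<longrightarrow>
     (\<exists>(T::'c monoid) \<phi>. C T \<and> \<phi> \<in> hom G T \<and> \<phi> g \<noteq> \<one>\<^bsub>T\<^esub>))"
    (is "_ = ?r")
proof
  show "residually C G \<Longrightarrow> ?r" unfolding residually_def by meson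
next
  assume r: ?r
  show "residually C G" unfolding residually_def
  proof (intro ballI impI)
    fix g assume g: "g \<in> carrier G" "g \<noteq> \<one>\<^bsub>G\<^esub>"
    with r obtain T :: "'c monoid" and \<phi> where T: "C T" "\<phi> \<in> hom G T" "\<phi> g \<noteq> \<one>\<^bsub>T\<^esub>" by blast
    have gT: "group T" using assms(1) T(1) by (rule group_classD)
    interpret group_hom G T \<phi>
      using T gT assms by (simp add: group_hom_def group_hom_axioms_def)
    let ?I = "T\<lparr>carrier := \<phi> ` carrier G\<rparr>"
    have "in_cls C ?I"
      using assms(2) T(1) img_is_subgroup by (auto simp: closed_subgroups_def)
    then obtain Y k where Y: "C Y" "k \<in> iso ?I Y" by (rule in_cls_E)
    have gI: "group ?I" using \<open>in_cls C ?I\<close> by (simp add: in_cls_def)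
    have gY: "group Y" using assms(1) Y(1) by (rule group_classD)
    have phi: "\<phi> \<in> hom G ?I" using T(2) by (auto simp: hom_def)
    have kI: "k \<in> hom ?I Y" "inj_on k (\<phi> ` carrier G)" "k ` \<phi> ` carrier G = carrier Y"
      using Y(2) by (auto simp: Group.iso_iff)
    have "k \<circ> \<phi> \<in> hom G Y" using phi kI(1) by (rule Group.hom_compose)
    moreover have "(k \<circ> \<phi>) ` carrier G = carrier Y" using kI(3) by (simp add: image_comp)
    moreover have "k \<one>\<^bsub>T\<^esub> = \<one>\<^bsub>Y\<^esub>"
      using group_hom.hom_one[of ?I Y k] gI gY kI(1)
      by (simp add: group_hom_def group_hom_axioms_def)
    then have "(k \<circ> \<phi>) g \<noteq> \<one>\<^bsub>Y\<^esub>"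
      using inj_onD[OF kI(2), of "\<phi> g" "\<one>\<^bsub>T\<^esub>"] g T(3) hom_one one_closed
      by (metis comp_apply image_eqI G.one_closed)
    ultimately show "\<exists>(T::'c monoid) \<phi>. C T \<and> \<phi> \<in> hom G T \<and> \<phi> ` carrier G = carrier T \<and>
      \<phi> g \<noteq> \<one>\<^bsub>T\<^esub>"
      using Y(1) by blast
  qed
qed

section \<open>The Gruenberg condition and extensions in terms of homomorphisms\<close>

text \<open>The chain is the kernel of \<open>k\<close> inside the kernel of \<open>h\<close> inside
  \<open>G\<close>, and the kernel of \<open>q\<close> is, up to the copy, the subgroup
  \<open>L\<close> of the Gruenberg condition. The bound on \<open>carrier G\<close> allows a copy
  of \<open>G\<close> over \<open>'c\<close>, where that condition is available.\<close>

lemma gruenberg_hom: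
  fixes R :: "'c monoid \<Rightarrow> bool"
  assumes R: "root_class R" and G: "group G" "carrier G \<lesssim> (UNIV::'c set)"
    and h: "in_cls R T" "h \<in> hom G T"
    and k: "in_cls R Y" "k \<in> hom (G\<lparr>carrier := kernel G T h\<rparr>) Y"
  obtains Z :: "'c monoid" and q where "R Z" "q \<in> hom G Z"
    "\<And>x. x \<in> carrier G \<Longrightarrow> q x = \<one>\<^bsub>Z\<^esub> \<Longrightarrow> h x = \<one>\<^bsub>T\<^esub> \<and> k x = \<one>\<^bsub>Y\<^esub>"
proof -
  have R': "group_class R" "closed_subgroups R" "gruenberg R"
    using R by (auto simp: root_class_def)
  obtain g :: "_ \<Rightarrow> 'c" where g: "inj_on g (carrier G)" using G(2) by (auto simp: lepoll_def)
  obtain G' :: "'c monoid" where G': "group G'" "g \<in> iso G G'" "carrier G' = g ` carrier G"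
    using group_copy[OF G(1) g] by blast
  define f where "f = inv_into (carrier G) g"
  have f: "f \<in> iso G' G" unfolding f_def using group.iso_set_sym[OF G(1) G'(2)] .
  have fg: "f (g x) = x" if "x \<in> carrier G" for x
    using that g by (simp add: f_def)
  have gT: "group T" "group Y" using h(1) k(1) by (auto simp: in_cls_def)
  have fh: "f \<in> hom G' G" using f by (simp add: Group.iso_iff)
  have hf: "h \<circ> f \<in> hom G' T" using fh h(2) by (rule Group.hom_compose)
  interpret hf: group_hom G' T "h \<circ> f"
    using hf G' gT by (simp add: group_hom_def group_hom_axioms_def)
  let ?H = "kernel G' T (h \<circ> f)"
  let ?GH = "G'\<lparr>carrier := ?H\<rparr>"
  have gH: "group ?GH"
    using G'(1) hf.subgroup_kernel subgroup.subgroup_is_group by blast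
  have kf: "k \<circ> f \<in> hom ?GH Y"
  proof (rule homI)
    fix x assume "x \<in> carrier ?GH"
    then have "f x \<in> kernel G T h" using fh by (auto simp: kernel_def hom_def)
    then show "(k \<circ> f) x \<in> carrier Y" using k(2) by (auto simp: hom_def)
  next
    fix x y assume xy: "x \<in> carrier ?GH" "y \<in> carrier ?GH"
    then have "f x \<in> kernel G T h" "f y \<in> kernel G T h" using fh by (auto simp: kernel_def hom_def)
    moreover have "f (x \<otimes>\<^bsub>G'\<^esub> y) = f x \<otimes>\<^bsub>G\<^esub> f y" using xy fh by (auto simp: kernel_def hom_def)
    ultimately show "(k \<circ> f) (x \<otimes>\<^bsub>?GH\<^esub> y) = (k \<circ> f) x \<otimes>\<^bsub>Y\<^esub> (k \<circ> f) y"
      using k(2) by (auto simp: hom_def)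
  qed
  interpret kf: group_hom ?GH Y "k \<circ> f"
    using kf gH gT by (simp add: group_hom_def group_hom_axioms_def)
  let ?K = "kernel ?GH Y (k \<circ> f)"
  have "in_cls R (G' Mod ?H)" "in_cls R (?GH Mod ?K)"
    using in_cls_quotient[OF R'(1,2) h(1) G'(1) hf] in_cls_quotient[OF R'(1,2) k(1) gH kf] .
  then obtain L where L: "normal L G'" "L \<subseteq> ?K" "in_cls R (G' Mod L)"
    using R'(3) G'(1) hf.normal_kernel kf.normal_kernel unfolding gruenberg_def by blast
  interpret L: normal L G' by fact
  obtain Z j where Z: "R Z" "j \<in> iso (G' Mod L) Z" using L(3) by (rule in_cls_E)
  have gZ: "group Z" using R'(1) Z(1) by (rule group_classD)
  interpret j: group_hom "G' Mod L" Z j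
    using gZ Z L.factorgroup_is_group by (simp add: group_hom_def group_hom_axioms_def Group.iso_iff)
  show ?thesis
  proof
    show "R Z" by fact
    have "(\<lambda>a. L #>\<^bsub>G'\<^esub> a) \<circ> g \<in> hom G (G' Mod L)"
      using Group.hom_compose[OF _ L.r_coset_hom_Mod] G'(2) by (auto simp: Group.iso_iff)
    then show "j \<circ> ((\<lambda>a. L #>\<^bsub>G'\<^esub> a) \<circ> g) \<in> hom G Z"
      using j.homh by (rule Group.hom_compose)
    fix x assume x: "x \<in> carrier G" "(j \<circ> ((\<lambda>a. L #>\<^bsub>G'\<^esub> a) \<circ> g)) x = \<one>\<^bsub>Z\<^esub>"
    have gx: "g x \<in> carrier G'" using x G' by auto
    have "L #>\<^bsub>G'\<^esub> g x \<in> carrier (G' Mod L)"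
      using gx L.r_coset_hom_Mod by (auto simp: hom_def)
    moreover have "j (L #>\<^bsub>G'\<^esub> g x) = j \<one>\<^bsub>G' Mod L\<^esub>" using x(2) unfolding j.hom_one by simp
    ultimately have "L #>\<^bsub>G'\<^esub> g x = \<one>\<^bsub>G' Mod L\<^esub>"
      using Z(2) j.G.one_closed by (auto simp: Group.iso_iff inj_on_def)
    then have "L #>\<^bsub>G'\<^esub> g x = L" by (simp add: FactGroup_def)
    then have "g x \<in> L"
      using group.rcos_self[OF G'(1) gx L.subgroup_axioms] by simp
    then have "g x \<in> ?K" using L(2) by blast
    then show "h x = \<one>\<^bsub>T\<^esub> \<and> k x = \<one>\<^bsub>Y\<^esub>" using fg x by (simp add: kernel_def)
  qed
qed

text \<open>The quotient by the kernel of \<open>h\<close> embeds in \<open>T\<close>, so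
  \<open>G\<close> is an extension of a group of \<open>R\<close> by a group of \<open>C\<close>. As
  before, the cardinality bound allows the copy over \<open>'c\<close> to which
  \<open>closed_ext\<close> applies.\<close>

lemma closed_ext_hom:
  fixes R C :: "'c monoid \<Rightarrow> bool"
  assumes R: "group_class R" "closed_subgroups R"
    and C: "group_class C" "closed_subgroups C" and ext: "closed_ext R C"
    and G: "group G" "carrier G \<lesssim> (UNIV::'c set)"
    and h: "in_cls C T" "h \<in> hom G T"
    and N: "in_cls R (G\<lparr>carrier := kernel G T h\<rparr>)"
  shows "in_cls C G"
proof -
  obtain g :: "_ \<Rightarrow> 'c" where g: "inj_on g (carrier G)" using G(2) by (auto simp: lepoll_def)
  obtain G' :: "'c monoid" where G': "group G'" "g \<in> iso G G'" "carrier G' = g ` carrier G"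
    using group_copy[OF G(1) g] by blast
  define f where "f = inv_into (carrier G) g"
  have f: "f \<in> iso G' G" unfolding f_def using group.iso_set_sym[OF G(1) G'(2)] .
  have gT: "group T" using h(1) by (auto simp: in_cls_def)
  have fh: "f \<in> hom G' G" "inj_on f (carrier G')" using f by (auto simp: Group.iso_iff)
  have hf: "h \<circ> f \<in> hom G' T" using fh(1) h(2) by (rule Group.hom_compose)
  interpret hf: group_hom G' T "h \<circ> f"
    using hf G' gT by (simp add: group_hom_def group_hom_axioms_def)
  let ?H = "kernel G' T (h \<circ> f)"
  let ?GH = "G'\<lparr>carrier := ?H\<rparr>"
  have gH: "group ?GH"
    using G'(1) hf.subgroup_kernel subgroup.subgroup_is_group by blast
  have "in_cls R ?GH"
  proof (rule in_cls_inj[OF R N gH])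
    show "f \<in> hom ?GH (G\<lparr>carrier := kernel G T h\<rparr>)"
      using fh by (auto simp: hom_def kernel_def)
    show "inj_on f (carrier ?GH)"
      using fh(2) by (auto simp: kernel_def inj_on_def)
  qed
  moreover have "in_cls C (G' Mod ?H)"
    using in_cls_quotient[OF C h(1) G'(1) hf] .
  ultimately have "C G'"
    using ext G'(1) hf.normal_kernel by (auto simp: closed_ext_def)
  then show ?thesis using G(1) G'(2) by (auto simp: in_cls_def is_iso_def)
qed

section \<open>Cardinalities\<close>

lemma Times_lepoll_UNIV:
  assumes "infinite (UNIV :: 'c set)" "A \<lesssim> (UNIV :: 'c set)" "B \<lesssim> (UNIV :: 'c set)"
  shows "A \<times> B \<lesssim> (UNIV :: 'c set)"
proof -
  have "(UNIV :: 'c set) \<times> (UNIV :: 'c set) \<approx> (UNIV :: 'c set)"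
    using card_of_Times_same_infinite[OF assms(1)] by (simp add: eqpoll_iff_card_of_ordIso)
  then show ?thesis
    using times_lepoll_mono[OF assms(2,3)] lepoll_trans2 by blast
qed

lemma Un_lepoll_UNIV:
  assumes "infinite (UNIV :: 'c set)" "A \<lesssim> (UNIV :: 'c set)" "B \<lesssim> (UNIV :: 'c set)"
  shows "A \<union> B \<lesssim> (UNIV :: 'c set)"
proof -
  obtain f :: "'c \<Rightarrow> _" and g :: "'c \<Rightarrow> _" where "A \<subseteq> range f" "B \<subseteq> range g"
    using assms(2,3) by (auto simp: lepoll_iff)
  then have "A \<union> B \<subseteq> (\<lambda>p. if fst p then f (snd p) else g (snd p)) ` (UNIV \<times> UNIV)"
    unfolding subset_iff Un_iff image_iff by (metis UNIV_I fst_conv mem_Times_iff snd_conv)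
  then have "A \<union> B \<lesssim> (UNIV :: bool set) \<times> (UNIV :: 'c set)" by (rule subset_image_lepoll)
  also have "\<dots> \<lesssim> (UNIV :: 'c set)"
    by (rule Times_lepoll_UNIV[OF assms(1) finite_lepoll_infinite[OF assms(1)] lepoll_refl]) simp
  finally show ?thesis .
qed

lemma lists_lepoll_UNIV:
  assumes "infinite (UNIV :: 'c set)" "A \<lesssim> (UNIV :: 'c set)"
  shows "lists A \<lesssim> (UNIV :: 'c set)"
proof -
  have "(UNIV :: 'c set) \<times> (UNIV :: 'c set) \<lesssim> (UNIV :: 'c set)"
    by (rule Times_lepoll_UNIV[OF assms(1) lepoll_refl lepoll_refl])
  then obtain p :: "'c \<times> 'c \<Rightarrow> 'c" where p: "inj p"
    unfolding lepoll_def UNIV_Times_UNIV by blast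
  \<comment> \<open>The fold \<open>enc\<close> is injective only among lists of equal length, which
    is why the length is recorded next to it below.\<close>
  define enc where "enc = (\<lambda>xs :: 'c list. foldr (\<lambda>x y. p (x, y)) xs undefined)"
  have enc: "xs = ys" if "length xs = length ys" "enc xs = enc ys" for xs ys
    using that by (induction xs ys rule: list_induct2) (auto simp: enc_def dest!: injD[OF p])
  have "lists A \<lesssim> lists (UNIV :: 'c set)" using assms(2) by (rule lists_lepoll_mono)
  also have "\<dots> \<lesssim> (UNIV :: nat set) \<times> (UNIV :: 'c set)"
    unfolding lepoll_def by (rule exI[of _ "\<lambda>xs. (length xs, enc xs)"]) (auto intro!: inj_onI enc)
  also have "\<dots> \<lesssim> (UNIV :: 'c set)"
    using assms(1) by (intro Times_lepoll_UNIV[OF assms(1) _ lepoll_refl])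
      (simp only: infinite_le_lepoll)
  finally show ?thesis .
qed

text \<open>If \<open>'c\<close> were finite, \<open>R\<close> would have a nontrivial member of
  largest order, and the direct square of that member would be a larger one. Once \<open>'c\<close>
  is infinite, it absorbs binary products and finite words.\<close>

lemma root_class_infinite:
  fixes R :: "'c monoid \<Rightarrow> bool"
  assumes "root_class R"
  shows "infinite (UNIV :: 'c set)"
proof
  assume fin: "finite (UNIV :: 'c set)"
  have R: "group_class R" "closed_dirprod R" using assms by (auto simp: root_class_def)
  have finc: "finite A" for A :: "'c set" using fin by (rule finite_subset[rotated]) simp
  let ?N = "{n. \<exists>T. R T \<and> card (carrier T) = n \<and> carrier T \<noteq> {\<one>\<^bsub>T\<^esub>}}"
  have "?N \<subseteq> {..card (UNIV :: 'c set)}" using fin by (auto intro: card_mono)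
  then have fN: "finite ?N" by (rule finite_subset) simp
  have "?N \<noteq> {}" using assms by (auto simp: root_class_def)
  then have "Max ?N \<in> ?N" using fN by (rule Max_in[rotated])
  then obtain T where T: "R T" "card (carrier T) = Max ?N" "carrier T \<noteq> {\<one>\<^bsub>T\<^esub>}" by blast
  interpret T: group T using R(1) T(1) by (rule group_classD)
  have "card (carrier T) \<noteq> 1" using T(3) T.one_closed by (metis card_1_singletonE singletonD)
  moreover have "card (carrier T) \<noteq> 0" using T.one_closed finc by (auto simp: card_eq_0_iff)
  ultimately have n2: "card (carrier T) > 1" by linarith
  obtain Y h where Y: "R Y" "h \<in> iso (T \<times>\<times> T) Y"
    using R(2) T(1) in_cls_E unfolding closed_dirprod_def by metis
  have "card (carrier Y) = card (carrier T) * card (carrier T)"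
    using bij_betw_same_card[of h "carrier (T \<times>\<times> T)" "carrier Y"] Y(2)
    by (simp add: iso_def card_cartesian_product DirProd_def)
  then have gt: "card (carrier Y) > Max ?N" using n2 T(2) by simp
  then have "carrier Y \<noteq> {\<one>\<^bsub>Y\<^esub>}" using n2 T(2) by auto
  then have "card (carrier Y) \<in> ?N" using Y(1) by blast
  then have "card (carrier Y) \<le> Max ?N" using fN by (rule Max_ge[rotated])
  with gt show False by simp
qed

section \<open>Words and the universal property of the double\<close>

definition mprod :: "('a, 'm) monoid_scheme \<Rightarrow> 'a list \<Rightarrow> 'a" where
  "mprod G xs = foldr (mult G) xs \<one>\<^bsub>G\<^esub>"

lemma mprod_simps [simp]:
  "mprod G [] = \<one>\<^bsub>G\<^esub>" "mprod G (x # xs) = x \<otimes>\<^bsub>G\<^esub> mprod G xs"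
  by (simp_all add: mprod_def)

context group
begin

lemma mprod_closed [simp]: "set xs \<subseteq> carrier G \<Longrightarrow> mprod G xs \<in> carrier G"
  by (induction xs) auto

lemma mprod_append:
  "set xs \<subseteq> carrier G \<Longrightarrow> set ys \<subseteq> carrier G \<Longrightarrow> mprod G (xs @ ys) = mprod G xs \<otimes> mprod G ys"
  by (induction xs) (auto simp: m_assoc)

lemma generate_mprod:
  assumes "Y \<subseteq> carrier G" "\<And>y. y \<in> Y \<Longrightarrow> inv y \<in> Y"
  shows "generate G Y \<subseteq> mprod G ` lists Y"
proof
  fix g assume "g \<in> generate G Y"
  then show "g \<in> mprod G ` lists Y"
  proof induction
    case one
    show ?case by (rule image_eqI[of _ _ "[]"]) auto
  next
    case (incl h)
    then show ?case using assms(1) by (intro image_eqI[of _ _ "[h]"]) auto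
  next
    case (inv h)
    then show ?case using assms by (intro image_eqI[of _ _ "[inv h]"]) auto
  next
    case (eng a b)
    then obtain xs ys where "a = mprod G xs" "b = mprod G ys" "xs \<in> lists Y" "ys \<in> lists Y" by blast
    then show ?case using assms(1)
      by (intro image_eqI[of _ _ "xs @ ys"]) (auto simp: mprod_append in_lists_conv_set subset_iff)
  qed
qed

text \<open>The elements are words in \<open>Y\<close> and its inverses, and an infinite type
  absorbs finite words. This keeps the subgroups generated later small enough for a copy over
  \<open>'c\<close>.\<close>

lemma generate_lepoll:
  assumes "infinite (UNIV :: 'c set)" "Y \<subseteq> carrier G" "Y \<lesssim> (UNIV :: 'c set)"
  shows "generate G Y \<lesssim> (UNIV :: 'c set)"
proof -
  let ?Y = "Y \<union> (\<lambda>y. inv y) ` Y"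
  have "generate G Y \<subseteq> generate G ?Y" by (rule mono_generate) simp
  also have "\<dots> \<subseteq> mprod G ` lists ?Y"
    using assms(2) by (intro generate_mprod) auto
  finally have "generate G Y \<lesssim> lists ?Y" by (rule subset_image_lepoll)
  also have "\<dots> \<lesssim> (UNIV :: 'c set)"
    using assms lepoll_trans[OF image_lepoll assms(3)]
    by (intro lists_lepoll_UNIV Un_lepoll_UNIV) auto
  finally show ?thesis .
qed

end

lemma hom_mprod:
  assumes "group_hom G K h" "set xs \<subseteq> carrier G"
  shows "h (mprod G xs) = mprod K (map h xs)"
proof -
  interpret group_hom G K h by fact
  show ?thesis using assms(2) by (induction xs) auto
qed

text \<open>The universal property of the double only mentions one carrier type, but the subgroup
generated by the images of the two copies is a quotient of the words over \<open>'a \<times> bool\<close>.\<close>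
lemma double_hom:
  fixes A :: "('a, 'm) monoid_scheme"
  assumes D: "is_double A H G i1 i2" and A: "group A" and K: "group K"
    and f: "f1 \<in> hom A K" "f2 \<in> hom A K" "\<And>h. h \<in> H \<Longrightarrow> f1 h = f2 h"
  obtains \<phi> where "\<phi> \<in> hom G K" "\<And>a. a \<in> carrier A \<Longrightarrow> \<phi> (i1 a) = f1 a"
    "\<And>a. a \<in> carrier A \<Longrightarrow> \<phi> (i2 a) = f2 a"
proof -
  interpret K: group K by fact
  interpret f1: group_hom A K f1 using A K f by (simp add: group_hom_def group_hom_axioms_def)
  interpret f2: group_hom A K f2 using A K f by (simp add: group_hom_def group_hom_axioms_def)
  let ?Y = "f1 ` carrier A \<union> f2 ` carrier A"
  have Y: "?Y \<subseteq> carrier K" by auto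
  let ?K = "K\<lparr>carrier := generate K ?Y\<rparr>"
  \<comment> \<open>The tag selects the copy; evaluating tagged words then covers the subgroup
    generated by both images.\<close>
  let ?l = "\<lambda>p. if snd p then f2 (fst p) else f1 (fst p)"
  have sub: "subgroup (generate K ?Y) K" using Y by (rule K.generate_is_subgroup)
  have "generate K ?Y \<subseteq> mprod K ` lists ?Y"
  proof (rule K.generate_mprod[OF Y])
    fix y assume "y \<in> ?Y"
    then show "inv\<^bsub>K\<^esub> y \<in> ?Y"
      by (auto simp: f1.hom_inv[symmetric] f2.hom_inv[symmetric] simp del: f1.hom_inv f2.hom_inv)
  qed
  also have "\<dots> \<subseteq> mprod K ` map ?l ` lists (carrier A \<times> UNIV)"
  proof -
    have "?Y \<subseteq> ?l ` (carrier A \<times> UNIV)"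
      unfolding subset_iff Un_iff image_iff by (metis UNIV_I fst_conv mem_Times_iff snd_conv)
    then have "lists ?Y \<subseteq> map ?l ` lists (carrier A \<times> UNIV)"
      unfolding lists_image[symmetric] by (rule lists_mono)
    then show ?thesis by (rule image_mono)
  qed
  finally have "generate K ?Y \<subseteq> (mprod K \<circ> map ?l) ` lists (carrier A \<times> UNIV)"
    by (simp only: image_comp)
  then have "generate K ?Y \<lesssim> lists (carrier A \<times> (UNIV :: bool set))"
    by (rule subset_image_lepoll)
  then obtain g :: "_ \<Rightarrow> ('a \<times> bool) list" where g: "inj_on g (carrier ?K)"
    unfolding lepoll_def by auto
  have gK: "group ?K" using sub by (rule K.subgroup_imp_group)
  obtain K' :: "('a \<times> bool) list monoid"
    where K': "group K'" "g \<in> iso ?K K'" "carrier K' = g ` carrier ?K"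
    by (rule group_copy[OF gK g])
  have gh: "g \<in> hom ?K K'" using K'(2) by (simp add: Group.iso_iff)
  have fh: "f1 \<in> hom A ?K" "f2 \<in> hom A ?K"
    using f by (auto simp: hom_def intro: generate.incl)
  have "g \<circ> f1 \<in> hom A K'" "g \<circ> f2 \<in> hom A K'"
    using Group.hom_compose[OF fh(1) gh] Group.hom_compose[OF fh(2) gh] .
  moreover have "\<forall>h\<in>H. (g \<circ> f1) h = (g \<circ> f2) h" using f(3) by simp
  ultimately have "\<exists>\<phi>\<in>hom G K'. \<forall>a\<in>carrier A. \<phi> (i1 a) = (g \<circ> f1) a \<and> \<phi> (i2 a) = (g \<circ> f2) a"
    using D K'(1) unfolding is_double_def by blast
  then obtain \<psi> where \<psi>: "\<psi> \<in> hom G K'"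
    "\<And>a. a \<in> carrier A \<Longrightarrow> \<psi> (i1 a) = g (f1 a) \<and> \<psi> (i2 a) = g (f2 a)"
    unfolding comp_apply by blast
  \<comment> \<open>Undo the copy. This recovers the prescribed values on the generators, since
    \<open>f1\<close> and \<open>f2\<close> map into \<open>?K\<close>.\<close>
  let ?i = "inv_into (carrier ?K) g"
  have "?i \<in> iso K' ?K" using group.iso_set_sym[OF gK K'(2)] .
  then have "?i \<in> hom K' K"
    using K.generate_in_carrier[OF Y] by (auto simp: Group.iso_iff hom_def)
  then have "?i \<circ> \<psi> \<in> hom G K" using \<psi>(1) by (intro Group.hom_compose)
  moreover have "(?i \<circ> \<psi>) (i1 a) = f1 a" "(?i \<circ> \<psi>) (i2 a) = f2 a" if "a \<in> carrier A" for a
  proof -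
    have "f1 a \<in> carrier ?K" "f2 a \<in> carrier ?K" using that fh by (auto simp: hom_def)
    then show "(?i \<circ> \<psi>) (i1 a) = f1 a" "(?i \<circ> \<psi>) (i2 a) = f2 a"
      using that \<psi>(2) inv_into_f_f[OF g] by simp_all
  qed
  ultimately show ?thesis using that by blast
qed

section \<open>Wreath products\<close>

definition wreath :: "('u, 'm) monoid_scheme \<Rightarrow> ('c, 'n) monoid_scheme \<Rightarrow> (('c \<Rightarrow> 'u) \<times> 'c) monoid" where
  "wreath U C = \<lparr>carrier = (carrier C \<rightarrow>\<^sub>E carrier U) \<times> carrier C,
     mult = (\<lambda>(F, c) (F', c'). (\<lambda>x\<in>carrier C. F x \<otimes>\<^bsub>U\<^esub> F' (x \<otimes>\<^bsub>C\<^esub> c), c \<otimes>\<^bsub>C\<^esub> c')),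
     one = (\<lambda>x\<in>carrier C. \<one>\<^bsub>U\<^esub>, \<one>\<^bsub>C\<^esub>)\<rparr>"

lemma carrier_wreath: "carrier (wreath U C) = (carrier C \<rightarrow>\<^sub>E carrier U) \<times> carrier C"
  by (simp add: wreath_def)

lemma one_wreath: "\<one>\<^bsub>wreath U C\<^esub> = (\<lambda>x\<in>carrier C. \<one>\<^bsub>U\<^esub>, \<one>\<^bsub>C\<^esub>)"
  by (simp add: wreath_def)

lemma snd_mult_wreath: "snd (p \<otimes>\<^bsub>wreath U C\<^esub> q) = snd p \<otimes>\<^bsub>C\<^esub> snd q"
  by (simp add: wreath_def split: prod.split)

lemma fst_mult_wreath:
  "x \<in> carrier C \<Longrightarrow> fst (p \<otimes>\<^bsub>wreath U C\<^esub> q) x = fst p x \<otimes>\<^bsub>U\<^esub> fst q (x \<otimes>\<^bsub>C\<^esub> snd p)"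
  by (simp add: wreath_def split: prod.split)

lemma wreath_eqI:
  assumes "p \<in> carrier (wreath U C)" "q \<in> carrier (wreath U C)" "snd p = snd q"
    "\<And>x. x \<in> carrier C \<Longrightarrow> fst p x = fst q x"
  shows "p = q"
proof (rule prod_eqI)
  have "fst p \<in> carrier C \<rightarrow>\<^sub>E carrier U" "fst q \<in> carrier C \<rightarrow>\<^sub>E carrier U"
    using assms(1,2) by (simp_all only: carrier_wreath mem_Times_iff)
  then show "fst p = fst q" using assms(4) by (rule PiE_ext)
qed fact

locale wreath_groups = U: group U + C: group C for U (structure) and C (structure)
begin

abbreviation "W \<equiv> wreath U C"

definition winv where
  "winv p = (\<lambda>x\<in>carrier C. inv\<^bsub>U\<^esub> (fst p (x \<otimes>\<^bsub>C\<^esub> inv\<^bsub>C\<^esub> (snd p))), inv\<^bsub>C\<^esub> (snd p))"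

lemma fst_closed: "p \<in> carrier W \<Longrightarrow> x \<in> carrier C \<Longrightarrow> fst p x \<in> carrier U"
  by (auto simp: carrier_wreath mem_Times_iff PiE_mem simp del: mem_Sigma_iff)

lemma snd_closed: "p \<in> carrier W \<Longrightarrow> snd p \<in> carrier C"
  by (simp add: carrier_wreath mem_Times_iff)

lemma mult_closed:
  assumes "p \<in> carrier W" "q \<in> carrier W"
  shows "p \<otimes>\<^bsub>W\<^esub> q \<in> carrier W"
proof -
  have "p \<otimes>\<^bsub>W\<^esub> q = (\<lambda>x\<in>carrier C. fst p x \<otimes>\<^bsub>U\<^esub> fst q (x \<otimes>\<^bsub>C\<^esub> snd p), snd p \<otimes>\<^bsub>C\<^esub> snd q)"
    by (simp add: wreath_def split: prod.split)
  then show ?thesis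
    using assms by (simp add: carrier_wreath[of U C] fst_closed snd_closed)
qed

lemma winv_closed:
  assumes "p \<in> carrier W"
  shows "winv p \<in> carrier W"
proof -
  have "winv p \<in> (carrier C \<rightarrow>\<^sub>E carrier U) \<times> carrier C"
    unfolding winv_def using fst_closed[OF assms] snd_closed[OF assms] by auto
  then show ?thesis by (simp only: carrier_wreath)
qed

lemma group_wreath: "group W"
proof (rule groupI)
  show one: "\<one>\<^bsub>W\<^esub> \<in> carrier W" by (auto simp: wreath_def)
  fix p assume p: "p \<in> carrier W"
  show "\<one>\<^bsub>W\<^esub> \<otimes>\<^bsub>W\<^esub> p = p"
    using p by (intro wreath_eqI[of _ U C] mult_closed one)
      (auto simp: fst_mult_wreath snd_mult_wreath fst_closed snd_closed one_wreath)
  have "winv p \<otimes>\<^bsub>W\<^esub> p = \<one>\<^bsub>W\<^esub>"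
    using p by (intro wreath_eqI[of _ U C] mult_closed one winv_closed)
      (auto simp: fst_mult_wreath snd_mult_wreath winv_def fst_closed snd_closed one_wreath)
  then show "\<exists>q\<in>carrier W. q \<otimes>\<^bsub>W\<^esub> p = \<one>\<^bsub>W\<^esub>" using winv_closed[OF p] by blast
  fix q assume q: "q \<in> carrier W"
  show "p \<otimes>\<^bsub>W\<^esub> q \<in> carrier W" using p q by (rule mult_closed)
  fix r assume r: "r \<in> carrier W"
  show "p \<otimes>\<^bsub>W\<^esub> q \<otimes>\<^bsub>W\<^esub> r = p \<otimes>\<^bsub>W\<^esub> (q \<otimes>\<^bsub>W\<^esub> r)"
    using p q r by (intro wreath_eqI[of _ U C] mult_closed)
      (auto simp: fst_mult_wreath snd_mult_wreath fst_closed snd_closed U.m_assoc C.m_assoc)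
qed

sublocale W: group W by (rule group_wreath)

lemma inv_wreath: "p \<in> carrier W \<Longrightarrow> inv\<^bsub>W\<^esub> p = winv p"
  by (intro W.inv_equality winv_closed wreath_eqI[of _ U C] mult_closed W.one_closed)
    (auto simp: fst_mult_wreath snd_mult_wreath winv_def fst_closed snd_closed one_wreath)

lemma fst_inv_wreath:
  "p \<in> carrier W \<Longrightarrow> x \<in> carrier C \<Longrightarrow> fst (inv\<^bsub>W\<^esub> p) x = inv\<^bsub>U\<^esub> (fst p (x \<otimes>\<^bsub>C\<^esub> inv\<^bsub>C\<^esub> (snd p)))"
  by (simp add: inv_wreath winv_def)

lemma snd_hom: "snd \<in> hom W C"
  by (rule homI) (simp_all add: snd_closed snd_mult_wreath)

definition top where "top c = (\<lambda>x\<in>carrier C. \<one>\<^bsub>U\<^esub>, c)"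

lemma top_hom: "top \<in> hom C W"
  by (rule homI) (auto simp: top_def wreath_def)

end

section \<open>Small subgroups of wreath products inside \<open>R\<close> and
  \<open>C\<close>\<close>

text \<open>The Gruenberg condition gives a map \<open>q\<close> whose kernel consists of elements
  of trivial top part with trivial coordinate at the identity. This kernel is normal in a group
  containing the whole top group, so it is invariant under translations and therefore
  trivial.\<close>

lemma wreath_subgroup_in_cls:
  fixes R :: "'c monoid \<Rightarrow> bool"
  assumes R: "root_class R" "in_cls R M" "in_cls R S"
    and Q: "subgroup Q (wreath M S)" "Q \<lesssim> (UNIV :: 'c set)"
    and top: "\<And>s. s \<in> carrier S \<Longrightarrow> (\<lambda>x\<in>carrier S. \<one>\<^bsub>M\<^esub>, s) \<in> Q"
  shows "in_cls R (wreath M S\<lparr>carrier := Q\<rparr>)"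
proof -
  have R': "group_class R" "closed_subgroups R" using R(1) by (auto simp: root_class_def)
  have gMS: "group M" "group S" using R(2,3) by (auto simp: in_cls_def)
  interpret wreath_groups M S using gMS by (simp add: wreath_groups_def)
  interpret Q: subgroup Q W by fact
  let ?G = "W\<lparr>carrier := Q\<rparr>"
  have gG: "group ?G" using Q(1) by (rule W.subgroup_imp_group)
  have snd: "snd \<in> hom ?G S"
    using snd_hom Q.subset by (auto simp: hom_def)
  \<comment> \<open>For trivial top parts the product is coordinatewise, so evaluation at one
    coordinate is a homomorphism on the kernel of \<open>snd\<close>.\<close>
  have fst: "(\<lambda>p. fst p \<one>\<^bsub>S\<^esub>) \<in> hom (?G\<lparr>carrier := kernel ?G S snd\<rparr>) M"
    using Q.mem_carrier
    by (intro homI) (auto simp: kernel_def fst_mult_wreath intro: fst_closed)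
  have le: "carrier ?G \<lesssim> (UNIV :: 'c set)" using Q(2) by simp
  obtain Z :: "'c monoid" and q where q: "R Z" "q \<in> hom ?G Z"
    "\<And>x. x \<in> carrier ?G \<Longrightarrow> q x = \<one>\<^bsub>Z\<^esub> \<Longrightarrow> snd x = \<one>\<^bsub>S\<^esub> \<and> fst x \<one>\<^bsub>S\<^esub> = \<one>\<^bsub>M\<^esub>"
    by (rule gruenberg_hom[OF R(1) gG le R(3) snd R(2) fst]) blast
  have gZ: "group Z" using R'(1) q(1) by (rule group_classD)
  interpret q: group_hom ?G Z q
    using gZ gG q(2) by (simp add: group_hom_def group_hom_axioms_def)
  have ker: "x = \<one>\<^bsub>W\<^esub>" if x: "x \<in> Q" "q x = \<one>\<^bsub>Z\<^esub>" for x
  proof (rule wreath_eqI[of _ M S])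
    show "x \<in> carrier W" "\<one>\<^bsub>W\<^esub> \<in> carrier W" using x(1) by auto
    show "snd x = snd \<one>\<^bsub>W\<^esub>" using q(3)[of x] x by (simp add: one_wreath)
    fix s assume s: "s \<in> carrier S"
    \<comment> \<open>Conjugation by \<open>top s\<close> moves the coordinate at \<open>s\<close>
      to the identity, where elements of the kernel of \<open>q\<close> are known to be
      trivial.\<close>
    let ?t = "top s" and ?t' = "top (inv\<^bsub>S\<^esub> s)"
    have t: "?t \<in> Q" "?t' \<in> Q" using assms(6) s by (simp_all add: top_def)
    have tt: "?t \<otimes>\<^bsub>W\<^esub> ?t' = \<one>\<^bsub>W\<^esub>"
      using s hom_mult[OF top_hom, of s "inv\<^bsub>S\<^esub> s"] by (simp add: top_def one_wreath)
    have "q (?t \<otimes>\<^bsub>W\<^esub> x \<otimes>\<^bsub>W\<^esub> ?t') = q ?t \<otimes>\<^bsub>Z\<^esub> q x \<otimes>\<^bsub>Z\<^esub> q ?t'"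
      using t x(1) q.hom_mult[of "?t \<otimes>\<^bsub>W\<^esub> x" ?t'] q.hom_mult[of ?t x] by simp
    also have "\<dots> = q (?t \<otimes>\<^bsub>W\<^esub> ?t')"
      using t x q.hom_mult[of ?t ?t'] q.hom_closed[of ?t] by simp
    also have "\<dots> = \<one>\<^bsub>Z\<^esub>" using tt q.hom_one by simp
    finally have "fst (?t \<otimes>\<^bsub>W\<^esub> x \<otimes>\<^bsub>W\<^esub> ?t') \<one>\<^bsub>S\<^esub> = \<one>\<^bsub>M\<^esub>"
      using q(3)[of "?t \<otimes>\<^bsub>W\<^esub> x \<otimes>\<^bsub>W\<^esub> ?t'"] t x(1) by simp
    moreover have "snd x = \<one>\<^bsub>S\<^esub>" using q(3)[of x] x by simp
    ultimately have "fst x s = \<one>\<^bsub>M\<^esub>"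
      using s x(1) fst_closed[of x s] by (simp add: fst_mult_wreath snd_mult_wreath top_def)
    then show "fst x s = fst \<one>\<^bsub>W\<^esub> s" using s by (simp add: one_wreath)
  qed
  have "inj_on q (carrier ?G)"
    unfolding q.inj_on_one_iff using ker by simp
  then show ?thesis
    using in_cls_inj[OF R' in_cls_self[OF R'(1) q(1)] gG q(2)] by simp
qed

text \<open>Adjoining the top group to \<open>Y\<close> and generating does not exceed the size of
  \<open>'c\<close>, so the result meets the hypotheses of
  \<open>wreath_subgroup_in_cls\<close>.\<close>

lemma wreath_absorb:
  fixes R :: "'c monoid \<Rightarrow> bool" and S :: "'c monoid"
  assumes R: "root_class R" "in_cls R M" "R S"
    and Y: "Y \<subseteq> carrier (wreath M S)" "Y \<lesssim> (UNIV :: 'c set)"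
  obtains Q where "subgroup Q (wreath M S)" "Y \<subseteq> Q" "in_cls R (wreath M S\<lparr>carrier := Q\<rparr>)"
proof -
  have R': "group_class R" using R(1) by (simp add: root_class_def)
  have gMS: "group M" "group S" using R(2) group_classD[OF R' R(3)] by (auto simp: in_cls_def)
  interpret wreath_groups M S using gMS by (simp add: wreath_groups_def)
  let ?Y = "Y \<union> top ` carrier S"
  have Y': "?Y \<subseteq> carrier W" using Y(1) top_hom by (auto simp: hom_def)
  have "top ` carrier S \<lesssim> (UNIV :: 'c set)"
    using image_lepoll by (rule lepoll_trans) (simp add: subset_imp_lepoll)
  then have "?Y \<lesssim> (UNIV :: 'c set)"
    using Y(2) root_class_infinite[OF R(1)] by (intro Un_lepoll_UNIV)
  then have le: "generate W ?Y \<lesssim> (UNIV :: 'c set)"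
    using Y' root_class_infinite[OF R(1)] by (intro W.generate_lepoll)
  show ?thesis
  proof
    show sub: "subgroup (generate W ?Y) W" using Y' by (rule W.generate_is_subgroup)
    show "Y \<subseteq> generate W ?Y" by (auto intro: generate.incl)
    show "in_cls R (W\<lparr>carrier := generate W ?Y\<rparr>)"
    proof (rule wreath_subgroup_in_cls[OF R(1,2) in_cls_self[OF R' R(3)] sub le])
      fix s assume "s \<in> carrier S"
      then have "top s \<in> generate W ?Y" by (auto intro: generate.incl)
      then show "(\<lambda>x\<in>carrier S. \<one>\<^bsub>M\<^esub>, s) \<in> generate W ?Y" by (simp add: top_def)
    qed
  qed
qed

text \<open>The kernel of \<open>snd\<close> on \<open>E\<close> consists of functions from
  \<open>T\<close> to \<open>U\<close>. Reindexed along \<open>f\<close> it sits in a wreath product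
  with top group \<open>S\<close> in \<open>R\<close>, so it lies in \<open>R\<close> by
  \<open>wreath_absorb\<close>, and \<open>E\<close> is an extension of it by a subgroup of
  \<open>T\<close>.\<close>

lemma wreath_subgroup_in_cls_ext:
  fixes R C :: "'c monoid \<Rightarrow> bool" and U S T :: "'c monoid"
  assumes R: "root_class R" and C: "group_class C" "closed_subgroups C" "closed_ext R C"
    and U: "R U" and T: "C T" and S: "R S" "bij_betw f (carrier T) (carrier S)"
    and E: "subgroup E (wreath U T)" "E \<lesssim> (UNIV :: 'c set)"
  shows "in_cls C (wreath U T\<lparr>carrier := E\<rparr>)"
proof -
  have R': "group_class R" "closed_subgroups R" using R(1) by (auto simp: root_class_def)
  have g: "group U" "group T" "group S"
    using group_classD[OF R'(1) U] group_classD[OF C(1) T] group_classD[OF R'(1) S(1)] .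
  interpret wreath_groups U T using g by (simp add: wreath_groups_def)
  interpret S: wreath_groups U S using g by (simp add: wreath_groups_def)
  interpret E: subgroup E W by fact
  let ?G = "W\<lparr>carrier := E\<rparr>"
  have gG: "group ?G" using E(1) by (rule W.subgroup_imp_group)
  have snd: "snd \<in> hom ?G T"
    using snd_hom E.subset by (auto simp: hom_def)
  interpret snd: group_hom ?G T snd
    using gG g snd by (simp add: group_hom_def group_hom_axioms_def)
  let ?N = "?G\<lparr>carrier := kernel ?G T snd\<rparr>"
  have gN: "group ?N" using group.subgroup_imp_group[OF gG snd.subgroup_kernel] .
  define b where "b = inv_into (carrier T) f"
  have b: "b s \<in> carrier T" if "s \<in> carrier S" for s
    using that S(2) by (simp add: b_def bij_betw_def inv_into_into)
  have bf: "f t \<in> carrier S" "b (f t) = t" if "t \<in> carrier T" for t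
    using that S(2) by (auto simp: b_def bij_betw_def)
  \<comment> \<open>In the kernel of \<open>snd\<close> multiplication is coordinatewise, so a mere
    bijection of the index sets suffices to transport it.\<close>
  define j where "j = (\<lambda>p :: ('c \<Rightarrow> 'c) \<times> 'c. (\<lambda>s\<in>carrier S. fst p (b s), \<one>\<^bsub>S\<^esub>))"
  have jc: "j p \<in> carrier (wreath U S)" if "p \<in> carrier W" for p
    using that b fst_closed by (auto simp: j_def carrier_wreath[of U S])
  have j: "j \<in> hom ?N (wreath U S)"
  proof (rule homI)
    fix p assume "p \<in> carrier ?N"
    then show "j p \<in> carrier (wreath U S)" using jc by (simp add: kernel_def)
  next
    fix p q assume pq: "p \<in> carrier ?N" "q \<in> carrier ?N"
    then have W: "p \<in> carrier W" "q \<in> carrier W" "snd p = \<one>\<^bsub>T\<^esub>" by (simp_all add: kernel_def)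
    show "j (p \<otimes>\<^bsub>?N\<^esub> q) = j p \<otimes>\<^bsub>wreath U S\<^esub> j q"
    proof (rule wreath_eqI[of _ U S])
      show "j (p \<otimes>\<^bsub>?N\<^esub> q) \<in> carrier (wreath U S)"
        using jc[OF mult_closed[OF W(1,2)]] by simp
      show "j p \<otimes>\<^bsub>wreath U S\<^esub> j q \<in> carrier (wreath U S)"
        using jc W by (intro S.mult_closed)
    qed (use W b in \<open>simp_all add: j_def fst_mult_wreath snd_mult_wreath\<close>)
  qed
  have inj: "inj_on j (carrier ?N)"
  proof (rule inj_onI)
    fix p q assume pq: "p \<in> carrier ?N" "q \<in> carrier ?N" "j p = j q"
    then have "p \<in> carrier W" "q \<in> carrier W" "snd p = snd q" by (auto simp: kernel_def)
    moreover have "fst p t = fst q t" if t: "t \<in> carrier T" for t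
      using fun_cong[OF arg_cong[OF pq(3), of fst], of "f t"] bf[OF t] by (simp add: j_def)
    ultimately show "p = q" by (rule wreath_eqI)
  qed
  have "j ` carrier ?N \<lesssim> E"
    by (rule lepoll_trans[OF image_lepoll]) (auto simp: kernel_def intro: subset_imp_lepoll)
  then have "j ` carrier ?N \<lesssim> (UNIV :: 'c set)" using E(2) by (rule lepoll_trans)
  then obtain Q where Q: "subgroup Q (wreath U S)" "j ` carrier ?N \<subseteq> Q"
    "in_cls R (wreath U S\<lparr>carrier := Q\<rparr>)"
    using wreath_absorb[OF R in_cls_self[OF R'(1) U] S(1)] hom_carrier[OF j] by blast
  have "j \<in> hom ?N (wreath U S\<lparr>carrier := Q\<rparr>)"
    using j Q(2) by (auto simp: hom_def)
  then have "in_cls R ?N" using in_cls_inj[OF R' Q(3) gN _ inj] by blast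
  then show ?thesis
    using closed_ext_hom[OF R' C gG _ in_cls_self[OF C(1) T] snd] E(2) by simp
qed

section \<open>Separating reduced words\<close>

text \<open>A word with labels \<open>z i\<close> and signs \<open>e i\<close> is evaluated under
  \<open>f\<close> on its first \<open>k\<close> letters. For growing \<open>k\<close> the values
  are the vertices of a path in the Cayley graph.\<close>

definition upath ::
  "('u, 'm) monoid_scheme \<Rightarrow> ('x \<Rightarrow> 'u) \<Rightarrow> (nat \<Rightarrow> 'x) \<Rightarrow> (nat \<Rightarrow> bool) \<Rightarrow> nat \<Rightarrow> 'u" where
  "upath U f z e k = mprod U (map (\<lambda>i. if e i then f (z i) else inv\<^bsub>U\<^esub> f (z i)) [0..<k])"

lemma upath_0 [simp]: "upath U f z e 0 = \<one>\<^bsub>U\<^esub>"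
  by (simp add: upath_def)

lemma (in group) upath_closed [simp]: "(\<And>x. f x \<in> carrier G) \<Longrightarrow> upath G f z e k \<in> carrier G"
  unfolding upath_def by (rule mprod_closed) auto

lemma (in group) upath_Suc:
  assumes "\<And>x. f x \<in> carrier G"
  shows "upath G f z e (Suc k) = upath G f z e k \<otimes> (if e k then f (z k) else inv f (z k))"
proof -
  have "mprod G (map (\<lambda>i. if e i then f (z i) else inv f (z i)) [0..<k] @
      [if e k then f (z k) else inv f (z k)]) =
    upath G f z e k \<otimes> mprod G [if e k then f (z k) else inv f (z k)]"
    unfolding upath_def using assms by (intro mprod_append) auto
  then show ?thesis using assms by (simp add: upath_def)
qed

lemma hom_upath:
  assumes "group_hom G K h" "\<And>x. f x \<in> carrier G"
  shows "h (upath G f z e k) = upath K (h \<circ> f) z e k"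
proof -
  interpret group_hom G K h by fact
  have "h (upath G f z e k) = mprod K (map h (map (\<lambda>i. if e i then f (z i) else inv\<^bsub>G\<^esub> f (z i)) [0..<k]))"
    unfolding upath_def using assms by (intro hom_mprod) auto
  also have "map h (map (\<lambda>i. if e i then f (z i) else inv\<^bsub>G\<^esub> f (z i)) [0..<k]) =
    map (\<lambda>i. if e i then (h \<circ> f) (z i) else inv\<^bsub>K\<^esub> (h \<circ> f) (z i)) [0..<k]"
    using assms(2) by auto
  finally show ?thesis by (simp add: upath_def)
qed

text \<open>A shortest closed subpath, from \<open>i\<close> to \<open>j\<close>, traverses its first edge only once, so a function on the Cayley graph supported on that edge separates the two ends in the wreath product.\<close>
lemma root_class_separate_step:
  fixes R :: "'c monoid \<Rightarrow> bool" and z :: "nat \<Rightarrow> 'x"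
  assumes R: "root_class R" and U: "R U" and f: "\<And>x. f x \<in> carrier U"
    and red: "\<And>k. Suc k < n \<Longrightarrow> z k = z (Suc k) \<Longrightarrow> e k = e (Suc k)"
    and ij: "i < j" "j \<le> n" "upath U f z e i = upath U f z e j"
    and min: "\<And>a b. a < b \<Longrightarrow> b \<le> n \<Longrightarrow> upath U f z e a = upath U f z e b \<Longrightarrow> j - i \<le> b - a"
  obtains U' f' where "R U'" "\<And>x. f' x \<in> carrier U'"
    "\<And>a b. upath U' f' z e a = upath U' f' z e b \<Longrightarrow> upath U f z e a = upath U f z e b"
    "upath U' f' z e i \<noteq> upath U' f' z e j"
proof -
  have R': "group_class R" "closed_subgroups R" using R by (auto simp: root_class_def)
  obtain M where M: "R M" "carrier M \<noteq> {\<one>\<^bsub>M\<^esub>}" using R by (auto simp: root_class_def)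
  have g: "group M" "group U" using group_classD[OF R'(1) M(1)] group_classD[OF R'(1) U] .
  interpret wreath_groups M U using g by (simp add: wreath_groups_def)
  obtain m where m: "m \<in> carrier M" "m \<noteq> \<one>\<^bsub>M\<^esub>" using M(2) U.one_closed by blast
  let ?v = "upath U f z e"
  have v: "?v k \<in> carrier U" for k using f by simp
  have vS: "?v (Suc k) = ?v k \<otimes>\<^bsub>U\<^esub> (if e k then f (z k) else inv\<^bsub>U\<^esub> f (z k))" for k
    using f by (rule C.upath_Suc)
  \<comment> \<open>The vertex from which the \<open>k\<close>-th edge starts in its positive
    orientation; a negative letter traverses the edge backwards and ends there.\<close>
  define org where "org = (\<lambda>k. if e k then ?v k else ?v (Suc k))"
  \<comment> \<open>The function supported on the edge number \<open>i\<close>: the generator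
    \<open>z i\<close> gets the value \<open>m\<close> at the origin of that edge, and every other
    value is trivial.\<close>
  define F where "F = (\<lambda>b. \<lambda>u\<in>carrier U. if b \<and> u = org i then m else \<one>\<^bsub>M\<^esub>)"
  define fW where "fW = (\<lambda>x. (F (x = z i), f x))"
  have fW: "fW x \<in> carrier W" for x
    using m(1) f by (auto simp: fW_def F_def carrier_wreath)
  \<comment> \<open>Only two base functions occur, so the new generators form a set of size at most
    that of \<open>'c\<close>, as \<open>wreath_absorb\<close> needs.\<close>
  have "range fW \<subseteq> range F \<times> (UNIV :: 'c set)" by (auto simp: fW_def)
  then have "range fW \<lesssim> range F \<times> (UNIV :: 'c set)" by (rule subset_imp_lepoll)
  also have "\<dots> \<lesssim> (UNIV :: 'c set)"
    using root_class_infinite[OF R]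
    by (intro Times_lepoll_UNIV lepoll_refl finite_lepoll_infinite[of "UNIV :: 'c set"]) auto
  finally have le: "range fW \<lesssim> (UNIV :: 'c set)" .
  obtain Q where Q: "subgroup Q W" "range fW \<subseteq> Q" "in_cls R (W\<lparr>carrier := Q\<rparr>)"
    using wreath_absorb[OF R in_cls_self[OF R'(1) M(1)] U _ le] fW by blast
  obtain U' h where U': "R U'" "h \<in> iso (W\<lparr>carrier := Q\<rparr>) U'" using Q(3) by (rule in_cls_E)
  have gQ: "group (W\<lparr>carrier := Q\<rparr>)" using Q(1) by (rule W.subgroup_imp_group)
  interpret h: group_hom "W\<lparr>carrier := Q\<rparr>" U' h
    using gQ U' group_classD[OF R'(1)] by (simp add: group_hom_def group_hom_axioms_def Group.iso_iff)
  interpret incl: group_hom "W\<lparr>carrier := Q\<rparr>" W "\<lambda>x. x"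
    using gQ W.is_group subgroup.subset[OF Q(1)]
    by (auto simp: group_hom_def group_hom_axioms_def hom_def)
  interpret snd: group_hom W U snd
    using snd_hom g by (simp add: group_hom_def group_hom_axioms_def W.is_group)
  let ?w = "upath W fW z e"
  have fQ: "fW x \<in> carrier (W\<lparr>carrier := Q\<rparr>)" for x using Q(2) by auto
  have wQ: "upath (W\<lparr>carrier := Q\<rparr>) fW z e k = ?w k" for k
    using hom_upath[OF incl.group_hom_axioms, where f = fW and z = z and e = e and k = k, OF fQ] by (simp add: comp_def)
  have wQ': "?w k \<in> Q" for k
    using h.G.upath_closed[of fW z e k] fQ unfolding wQ by simp
  have hw: "upath U' (h \<circ> fW) z e k = h (?w k)" for k
    using hom_upath[OF h.group_hom_axioms, where f = fW and z = z and e = e and k = k, OF fQ] by (simp add: wQ)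
  have sw: "snd (?w k) = ?v k" for k
    using hom_upath[OF snd.group_hom_axioms, where f = fW and z = z and e = e and k = k, OF fW] by (simp add: comp_def fW_def)
  have hinj: "?w a = ?w b" if "h (?w a) = h (?w b)" for a b
    using that U'(2) wQ'[of a] wQ'[of b] by (simp add: Group.iso_iff inj_on_def)
  let ?A = "\<lambda>k. fst (?w k) \<one>\<^bsub>U\<^esub>"
  have A: "?A k \<in> carrier M" for k
    using W.upath_closed[of fW z e k] fW by (intro fst_closed) auto
  \<comment> \<open>The coordinate at the identity counts traversals of the edge number
    \<open>i\<close>: it changes by \<open>m\<close> or its inverse exactly then.\<close>
  have AS: "?A (Suc k) = ?A k \<otimes>\<^bsub>M\<^esub> (if z k = z i \<and> org k = org i
      then if e k then m else inv\<^bsub>M\<^esub> m else \<one>\<^bsub>M\<^esub>)" for k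
  proof (cases "e k")
    case True
    then have "?A (Suc k) = ?A k \<otimes>\<^bsub>M\<^esub> fst (fW (z k)) (?v k)"
      using v by (simp add: W.upath_Suc[OF fW] fst_mult_wreath sw)
    also have "fst (fW (z k)) (?v k) = (if z k = z i \<and> org k = org i then m else \<one>\<^bsub>M\<^esub>)"
      using True v by (simp add: fW_def F_def org_def)
    finally show ?thesis using True by simp
  next
    case False
    have "?v (Suc k) = ?v k \<otimes>\<^bsub>U\<^esub> inv\<^bsub>U\<^esub> snd (fW (z k))"
      using False by (simp add: vS fW_def)
    then have "?A (Suc k) = ?A k \<otimes>\<^bsub>M\<^esub> inv\<^bsub>M\<^esub> fst (fW (z k)) (?v (Suc k))"
      using v False fW by (simp add: W.upath_Suc[OF fW] fst_mult_wreath sw fst_inv_wreath)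
    also have "fst (fW (z k)) (?v (Suc k)) = (if z k = z i \<and> org k = org i then m else \<one>\<^bsub>M\<^esub>)"
      using False v by (simp add: fW_def F_def org_def)
    finally show ?thesis using False by simp
  qed
  \<comment> \<open>If step \<open>k\<close> starts where step \<open>l\<close> ends, with the same
    label and the opposite sign, then it undoes step \<open>l\<close>.\<close>
  have cancel: "?v (Suc k) = ?v l" if "?v k = ?v (Suc l)" "z k = z l" "e k \<noteq> e l" for k l
  proof -
    have "?v (Suc k) = ?v l \<otimes>\<^bsub>U\<^esub> (if e l then f (z l) else inv\<^bsub>U\<^esub> f (z l))
        \<otimes>\<^bsub>U\<^esub> (if e k then f (z l) else inv\<^bsub>U\<^esub> f (z l))"
      using vS[of k] that(1,2) vS[of l] by simp
    also have "\<dots> = ?v l" using that(3) f v by (simp add: C.m_assoc)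
    finally show ?thesis .
  qed
  \<comment> \<open>A second traversal in the same direction would close up a shorter subpath. One
    in the opposite direction would do so too, unless it follows immediately, and such backtracking
    is excluded by \<open>red\<close>.\<close>
  have once: "\<not> (z k = z i \<and> org k = org i)" if k: "i < k" "k < j" for k
  proof
    assume same: "z k = z i \<and> org k = org i"
    show False
    proof (cases "e k = e i")
      case True
      then consider "?v i = ?v k" | "?v (Suc i) = ?v (Suc k)" using same by (auto simp: org_def split: if_splits)
      then show False using min[of i k] min[of "Suc i" "Suc k"] k ij by cases auto
    next
      case False
      have "?v k = ?v (Suc i)"
      proof (cases "e i")
        case True
        then have "?v (Suc k) = ?v i" using same False by (simp add: org_def)
        then have eq: "?v i = ?v (Suc k)" by simp
        from cancel[of i k, OF eq] same False show ?thesis by auto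
      next
        case e: False
        then show ?thesis using same False by (simp add: org_def)
      qed
      then have "k = Suc i" using min[of "Suc i" k] k ij by (cases "Suc i < k") auto
      then show False using red[of i] same False k ij by auto
    qed
  qed
  \<comment> \<open>After its first step the subpath never meets the edge again, so the coordinates
    at its two ends differ by exactly one factor \<open>m\<close> or its inverse.\<close>
  have "?A k = ?A (Suc i)" if "Suc i \<le> k" "k \<le> j" for k
    using that
  proof (induction k rule: dec_induct)
    case (step k)
    have "\<not> (z k = z i \<and> org k = org i)" using once[of k] step by simp
    then have "?A (Suc k) = ?A k" unfolding AS[of k] using A[of k] by (simp only: if_False U.r_one)
    then show ?case using step by simp
  qed simp
  then have "?A j = ?A i \<otimes>\<^bsub>M\<^esub> (if e i then m else inv\<^bsub>M\<^esub> m)"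
    using AS[of i] ij by simp
  moreover have "(if e i then m else inv\<^bsub>M\<^esub> m) \<noteq> \<one>\<^bsub>M\<^esub>" using m by simp
  ultimately have "?A j \<noteq> ?A i"
    using A[of i] m(1) U.r_cancel_one[of "?A i" "if e i then m else inv\<^bsub>M\<^esub> m"] by simp
  then have "?w i \<noteq> ?w j" by auto
  then have "upath U' (h \<circ> fW) z e i \<noteq> upath U' (h \<circ> fW) z e j"
    using hinj unfolding hw by blast
  moreover have "?v a = ?v b" if "upath U' (h \<circ> fW) z e a = upath U' (h \<circ> fW) z e b" for a b
    using hinj that unfolding hw by (metis sw)
  moreover have "(h \<circ> fW) x \<in> carrier U'" for x
    unfolding comp_apply using fQ by (rule h.hom_closed)
  ultimately show ?thesis using that[of U' "h \<circ> fW"] U'(1) by blast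
qed

text \<open>A form of the statement that free groups are residually \<open>R\<close>: all prefixes
  of a reduced word become distinct. The induction is on the number of coincident pairs of prefixes,
  since \<open>root_class_separate_step\<close> removes one and creates none.\<close>

lemma root_class_separates:
  fixes R :: "'c monoid \<Rightarrow> bool" and z :: "nat \<Rightarrow> 'x"
  assumes R: "root_class R"
    and red: "\<And>k. Suc k < n \<Longrightarrow> z k = z (Suc k) \<Longrightarrow> e k = e (Suc k)"
  obtains U f where "R U" "\<And>x. f x \<in> carrier U" "inj_on (upath U f z e) {..n}"
proof -
  define bad where "bad = (\<lambda>(U :: 'c monoid) (f :: 'x \<Rightarrow> 'c). {(i, j). i < j \<and> j \<le> n \<and> upath U f z e i = upath U f z e j})"
  have fin: "finite (bad U f)" for U f
    by (rule finite_subset[of _ "{..n} \<times> {..n}"]) (auto simp: bad_def)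
  have ex: "\<exists>U' f'. R U' \<and> (\<forall>x. f' x \<in> carrier U') \<and> bad U' f' = {}"
    if "R U" "\<And>x. f x \<in> carrier U" for U and f :: "'x \<Rightarrow> 'c"
    using that
  proof (induction "card (bad U f)" arbitrary: U f rule: less_induct)
    case less
    show ?case
    proof (cases "bad U f = {}")
      case True
      then show ?thesis using less.prems by blast
    next
      case False
      \<comment> \<open>A coincident pair at least distance is chosen, as the minimality condition
        of \<open>root_class_separate_step\<close> demands.\<close>
      then obtain p where p: "p \<in> bad U f" "\<And>q. q \<in> bad U f \<Longrightarrow> snd p - fst p \<le> snd q - fst q"
        using ex_has_least_nat[of "\<lambda>p. p \<in> bad U f" _ "\<lambda>p. snd p - fst p"] by blast
      obtain i j where ij: "p = (i, j)" by (cases p)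
      obtain U' f' where U': "R U'" "\<And>x. f' x \<in> carrier U'"
        "\<And>a b. upath U' f' z e a = upath U' f' z e b \<Longrightarrow> upath U f z e a = upath U f z e b"
        "upath U' f' z e i \<noteq> upath U' f' z e j"
      proof (rule root_class_separate_step[where z = z and e = e and n = n and i = i and j = j,
            OF R less.prems red])
        show "i < j" "j \<le> n" "upath U f z e i = upath U f z e j"
          using p(1) by (auto simp: bad_def ij)
        show "j - i \<le> b - a" if "a < b" "b \<le> n" "upath U f z e a = upath U f z e b" for a b
          using p(2)[of "(a, b)"] that by (simp add: bad_def ij)
      qed blast+
      have "bad U' f' \<subseteq> bad U f"
      proof (rule subrelI)
        fix a b assume "(a, b) \<in> bad U' f'"
        then show "(a, b) \<in> bad U f" using U'(3)[of a b] by (simp add: bad_def)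
      qed
      moreover have "p \<notin> bad U' f'" using U'(4) by (simp add: bad_def ij)
      ultimately have "bad U' f' \<subset> bad U f" using p(1) by blast
      then have "card (bad U' f') < card (bad U f)" using fin by (intro psubset_card_mono)
      then show ?thesis using less.hyps U'(1,2) by blast
    qed
  qed
  obtain M where M: "R M" using R by (auto simp: root_class_def)
  then have "group M" using R group_classD[of R M] unfolding root_class_def by blast
  then have "\<one>\<^bsub>M\<^esub> \<in> carrier M" by (simp add: group.is_monoid monoid.one_closed)
  \<comment> \<open>The induction starts from the trivial assignment, under which all prefixes
    coincide.\<close>
  then obtain U f where U: "R U" "\<And>x. f x \<in> carrier U" "bad U f = {}"
    using ex[OF M, of "\<lambda>_. \<one>\<^bsub>M\<^esub>"] by blast
  have "inj_on (upath U f z e) {..n}"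
    using U(3) by (intro linorder_inj_onI) (auto simp: bad_def)
  with U(1,2) show ?thesis using that by blast
qed

section \<open>Homomorphisms of the double\<close>

text \<open>The second map is the first one conjugated by the base element with function
  \<open>f\<close>. Constancy of \<open>f\<close> on the left cosets of the image of
  \<open>H\<close> says that this element commutes with the image of \<open>H\<close>, so the two
  maps agree on \<open>H\<close>.\<close>

lemma wreath_double_hom:
  fixes A :: "('a, 'm) monoid_scheme" and T :: "('t, 'n) monoid_scheme" and U :: "('u, 'k) monoid_scheme"
  assumes D: "is_double A H G i1 i2" and A: "group A" and T: "group T" "\<phi> \<in> hom A T"
    and H: "H \<subseteq> carrier A"
    and U: "group U" "\<And>x. x \<in> carrier T \<Longrightarrow> f x \<in> carrier U"
    and f: "\<And>x h. x \<in> carrier T \<Longrightarrow> h \<in> H \<Longrightarrow> f (x \<otimes>\<^bsub>T\<^esub> \<phi> h) = f x"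
  obtains \<psi> where "\<psi> \<in> hom G (wreath U T)"
    "\<And>a. a \<in> carrier A \<Longrightarrow> \<psi> (i1 a) = (\<lambda>x\<in>carrier T. \<one>\<^bsub>U\<^esub>, \<phi> a)"
    "\<And>a. a \<in> carrier A \<Longrightarrow> \<psi> (i2 a) = (\<lambda>x\<in>carrier T. inv\<^bsub>U\<^esub> f x \<otimes>\<^bsub>U\<^esub> f (x \<otimes>\<^bsub>T\<^esub> \<phi> a), \<phi> a)"
proof -
  interpret wreath_groups U T using U T by (simp add: wreath_groups_def)
  interpret phi: group_hom A T \<phi> using A T by (simp add: group_hom_def group_hom_axioms_def)
  let ?f1 = "\<lambda>a. (\<lambda>x\<in>carrier T. \<one>\<^bsub>U\<^esub>, \<phi> a)"
  let ?f2 = "\<lambda>a. (\<lambda>x\<in>carrier T. inv\<^bsub>U\<^esub> f x \<otimes>\<^bsub>U\<^esub> f (x \<otimes>\<^bsub>T\<^esub> \<phi> a), \<phi> a)"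
  have 1: "?f1 \<in> hom A W"
    using Group.hom_compose[OF T(2) top_hom] by (simp add: comp_def top_def)
  have c2: "?f2 a \<in> carrier W" if "a \<in> carrier A" for a
    using that U(2) by (auto simp: carrier_wreath)
  have 2: "?f2 \<in> hom A W"
  proof (rule homI[OF c2])
    fix a b assume ab: "a \<in> carrier A" "b \<in> carrier A"
    show "?f2 (a \<otimes>\<^bsub>A\<^esub> b) = ?f2 a \<otimes>\<^bsub>W\<^esub> ?f2 b"
    proof (rule wreath_eqI[of _ U T])
      show "?f2 (a \<otimes>\<^bsub>A\<^esub> b) \<in> carrier W" using ab by (intro c2) simp
      show "?f2 a \<otimes>\<^bsub>W\<^esub> ?f2 b \<in> carrier W" using c2 ab by (intro mult_closed)
      show "snd (?f2 (a \<otimes>\<^bsub>A\<^esub> b)) = snd (?f2 a \<otimes>\<^bsub>W\<^esub> ?f2 b)"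
        using ab by (simp add: snd_mult_wreath)
      fix x assume x: "x \<in> carrier T"
      define p where "p = f x"
      define q where "q = f (x \<otimes>\<^bsub>T\<^esub> \<phi> a)"
      define r where "r = f (x \<otimes>\<^bsub>T\<^esub> \<phi> a \<otimes>\<^bsub>T\<^esub> \<phi> b)"
      have pqr: "p \<in> carrier U" "q \<in> carrier U" "r \<in> carrier U"
        using U(2) x ab by (simp_all add: p_def q_def r_def)
      have "inv\<^bsub>U\<^esub> p \<otimes>\<^bsub>U\<^esub> r = inv\<^bsub>U\<^esub> p \<otimes>\<^bsub>U\<^esub> q \<otimes>\<^bsub>U\<^esub> (inv\<^bsub>U\<^esub> q \<otimes>\<^bsub>U\<^esub> r)"
        using pqr U.m_assoc[of q "inv\<^bsub>U\<^esub> q" r] by (simp add: U.m_assoc)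
      then show "fst (?f2 (a \<otimes>\<^bsub>A\<^esub> b)) x = fst (?f2 a \<otimes>\<^bsub>W\<^esub> ?f2 b) x"
        using x ab by (simp add: fst_mult_wreath p_def q_def r_def C.m_assoc)
    qed
  qed
  have "?f1 h = ?f2 h" if "h \<in> H" for h
    using that H f U(2) by (auto intro!: restrict_ext)
  from double_hom[OF D A group_wreath 1 2 this] that show ?thesis by blast
qed

definition letter :: "('a \<Rightarrow> 'g) \<Rightarrow> ('a \<Rightarrow> 'g) \<Rightarrow> 'a \<times> bool \<Rightarrow> 'g" where
  "letter i1 i2 p = (if snd p then i2 (fst p) else i1 (fst p))"

text \<open>Take a shortest word for \<open>g\<close>. Two neighbouring syllables from the same
  copy, or with one of them in \<open>H\<close>, could be merged into one.\<close>

lemma double_normal_form: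
  fixes A :: "('a, 'm) monoid_scheme"
  assumes D: "is_double A H G i1 i2" and A: "group A" and H: "subgroup H A" and g: "g \<in> carrier G"
  obtains l where "set l \<subseteq> carrier A \<times> UNIV" "g = mprod G (map (letter i1 i2) l)"
    "\<And>j. Suc j < length l \<Longrightarrow>
      fst (l ! j) \<notin> H \<and> fst (l ! Suc j) \<notin> H \<and> snd (l ! j) \<noteq> snd (l ! Suc j)"
proof -
  have D': "group G" "i1 \<in> hom A G" "i2 \<in> hom A G" "\<And>h. h \<in> H \<Longrightarrow> i1 h = i2 h"
    "generate G (i1 ` carrier A \<union> i2 ` carrier A) = carrier G"
    using D by (auto simp: is_double_def)
  interpret G: group G by fact
  interpret A: group A by fact
  interpret i1: group_hom A G i1 using A D' by (simp add: group_hom_def group_hom_axioms_def)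
  interpret i2: group_hom A G i2 using A D' by (simp add: group_hom_def group_hom_axioms_def)
  let ?l = "letter i1 i2"
  let ?Y = "i1 ` carrier A \<union> i2 ` carrier A"
  have lc: "?l p \<in> carrier G" if "p \<in> carrier A \<times> UNIV" for p
    using that by (auto simp: letter_def)
  have Yl: "?Y \<subseteq> ?l ` (carrier A \<times> UNIV)"
  proof (intro Un_least image_subsetI)
    fix a assume "a \<in> carrier A"
    then show "i1 a \<in> ?l ` (carrier A \<times> UNIV)" "i2 a \<in> ?l ` (carrier A \<times> UNIV)"
      by (auto simp: letter_def intro: image_eqI[of _ _ "(a, False)"] image_eqI[of _ _ "(a, True)"])
  qed
  have "generate G ?Y \<subseteq> mprod G ` lists ?Y"
  proof (rule G.generate_mprod)
    show "inv\<^bsub>G\<^esub> y \<in> ?Y" if "y \<in> ?Y" for y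
      using that by (auto simp: i1.hom_inv[symmetric] i2.hom_inv[symmetric] simp del: i1.hom_inv i2.hom_inv)
  qed auto
  then have "g \<in> mprod G ` map ?l ` lists (carrier A \<times> UNIV)"
    using g D'(5) lists_mono[OF Yl] unfolding lists_image by blast
  then obtain l0 where l0: "l0 \<in> lists (carrier A \<times> UNIV)" "g = mprod G (map ?l l0)" by blast
  define P where "P = (\<lambda>l. l \<in> lists (carrier A \<times> UNIV) \<and> g = mprod G (map ?l l))"
  have "P l0" using l0 by (simp add: P_def)
  then obtain l where "P l \<and> (\<forall>k. P k \<longrightarrow> length l \<le> length k)"
    using ex_has_least_nat[of P l0 length] by blast
  then have l: "l \<in> lists (carrier A \<times> UNIV)" "g = mprod G (map ?l l)"
    "\<And>k. k \<in> lists (carrier A \<times> UNIV) \<Longrightarrow> g = mprod G (map ?l k) \<Longrightarrow> length l \<le> length k"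
    unfolding P_def by blast+
  have red: "fst (l ! j) \<notin> H \<and> fst (l ! Suc j) \<notin> H \<and> snd (l ! j) \<noteq> snd (l ! Suc j)"
    if j: "Suc j < length l" for j
  proof (rule ccontr)
    assume neg: "\<not> ?thesis"
    obtain a x where p: "l ! j = (a, x)" by (cases "l ! j")
    obtain b y where q: "l ! Suc j = (b, y)" by (cases "l ! Suc j")
    have "l ! j \<in> carrier A \<times> UNIV" "l ! Suc j \<in> carrier A \<times> UNIV"
      using l(1) j nth_mem[of j l] nth_mem[of "Suc j" l] unfolding in_lists_conv_set by simp_all
    then have ab: "a \<in> carrier A" "b \<in> carrier A" using p q by auto
    have split: "l = take j l @ (a, x) # (b, y) # drop (Suc (Suc j)) l"
      using j p q id_take_nth_drop[of j l] Cons_nth_drop_Suc[of "Suc j" l] by simp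
    have sets: "set (take j l) \<subseteq> carrier A \<times> UNIV" "set (drop (Suc (Suc j)) l) \<subseteq> carrier A \<times> UNIV"
      using l(1) set_take_subset[of j l] set_drop_subset[of "Suc (Suc j)" l]
      unfolding in_lists_conv_set by blast+
    \<comment> \<open>An element of \<open>H\<close> can be read in either copy, so in each case
      both syllables can be taken from a common copy.\<close>
    have "\<exists>z. ?l (a, x) \<otimes>\<^bsub>G\<^esub> ?l (b, y) = ?l (a \<otimes>\<^bsub>A\<^esub> b, z)"
    proof -
      have "?l (a, x) = ?l (a, y) \<or> ?l (b, y) = ?l (b, x)"
        using neg p q D'(4) by (auto simp: letter_def)
      moreover have "?l (a, z) \<otimes>\<^bsub>G\<^esub> ?l (b, z) = ?l (a \<otimes>\<^bsub>A\<^esub> b, z)" for z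
        using ab by (simp add: letter_def)
      ultimately show ?thesis by metis
    qed
    then obtain z where z: "?l (a, x) \<otimes>\<^bsub>G\<^esub> ?l (b, y) = ?l (a \<otimes>\<^bsub>A\<^esub> b, z)" by blast
    let ?k = "take j l @ (a \<otimes>\<^bsub>A\<^esub> b, z) # drop (Suc (Suc j)) l"
    have c: "set (map ?l (take j l)) \<subseteq> carrier G" "set (map ?l (drop (Suc (Suc j)) l)) \<subseteq> carrier G"
      using sets lc by auto
    have ac: "?l (a, x) \<in> carrier G" "?l (b, y) \<in> carrier G" "?l (a \<otimes>\<^bsub>A\<^esub> b, z) \<in> carrier G"
      using lc ab by auto
    have "g = mprod G (map ?l (take j l) @ ?l (a, x) # ?l (b, y) # map ?l (drop (Suc (Suc j)) l))"
      using l(2) arg_cong[OF split, of "map ?l"] by simp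
    also have "\<dots> = mprod G (map ?l (take j l)) \<otimes>\<^bsub>G\<^esub>
        (?l (a, x) \<otimes>\<^bsub>G\<^esub> (?l (b, y) \<otimes>\<^bsub>G\<^esub> mprod G (map ?l (drop (Suc (Suc j)) l))))"
      using c ac by (subst G.mprod_append) (simp_all del: set_map set_drop_subset)
    also have "\<dots> = mprod G (map ?l (take j l)) \<otimes>\<^bsub>G\<^esub>
        (?l (a \<otimes>\<^bsub>A\<^esub> b, z) \<otimes>\<^bsub>G\<^esub> mprod G (map ?l (drop (Suc (Suc j)) l)))"
      using G.mprod_closed[OF c(2)] ac z by (simp add: G.m_assoc[symmetric])
    also have "\<dots> = mprod G (map ?l ?k)"
      using c ac by (simp only: map_append list.map, subst G.mprod_append) (simp_all del: set_map)
    finally have "g = mprod G (map ?l ?k)" .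
    moreover have "?k \<in> lists (carrier A \<times> UNIV)"
      using sets ab by (auto simp: in_lists_conv_set)
    ultimately have "length l \<le> length ?k" using l(3) by blast
    then show False using j by simp
  qed
  from l(1) have "set l \<subseteq> carrier A \<times> UNIV" by auto
  from that[OF this l(2) red] show ?thesis .
qed

section \<open>The pro-\<open>C\<close> topology and the main theorem\<close>

text \<open>The basic neighbourhoods of the identity in \<open>pro_top\<close>.\<close>

definition open_normal :: "('c monoid \<Rightarrow> bool) \<Rightarrow> ('a, 'm) monoid_scheme \<Rightarrow> 'a set \<Rightarrow> bool" where
  "open_normal C A N \<longleftrightarrow> normal N A \<and> in_cls C (A Mod N)"

text \<open>Together with \<open>open_normal_hom\<close> this identifies the open normal subgroups
  with the kernels of homomorphisms into members of the class.\<close>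

lemma open_normal_kernel:
  assumes "group_class C" "closed_subgroups C" "group A" "in_cls C T" "h \<in> hom A T"
  shows "open_normal C A (kernel A T h)"
proof -
  have "group T" using assms(4) by (simp add: in_cls_def)
  then have "group_hom A T h" using assms by (simp add: group_hom_def group_hom_axioms_def)
  then show ?thesis
    using in_cls_quotient[OF assms(1,2,4,3,5)] group_hom.normal_kernel by (auto simp: open_normal_def)
qed

lemma open_normal_hom:
  fixes C :: "'c monoid \<Rightarrow> bool"
  assumes "group_class C" "group A" "open_normal C A N"
  obtains T :: "'c monoid" and \<phi> where "C T" "\<phi> \<in> hom A T" "kernel A T \<phi> = N"
proof -
  interpret normal N A using assms(3) by (simp add: open_normal_def)
  obtain T j where T: "C T" "j \<in> iso (A Mod N) T"
    using assms(3) in_cls_E unfolding open_normal_def by blast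
  have gT: "group T"
    using assms(1) T(1) by (rule group_classD)
  interpret j: group_hom "A Mod N" T j
    using T factorgroup_is_group gT by (simp add: group_hom_def group_hom_axioms_def Group.iso_iff)
  have ker: "j (N #>\<^bsub>A\<^esub> a) = \<one>\<^bsub>T\<^esub> \<longleftrightarrow> a \<in> N" if a: "a \<in> carrier A" for a
  proof -
    have "N #>\<^bsub>A\<^esub> a \<in> carrier (A Mod N)" using a by (auto simp: FactGroup_def RCOSETS_def)
    then have "j (N #>\<^bsub>A\<^esub> a) = \<one>\<^bsub>T\<^esub> \<longleftrightarrow> N #>\<^bsub>A\<^esub> a = \<one>\<^bsub>A Mod N\<^esub>"
      using T(2) inj_on_eq_iff[of j "carrier (A Mod N)" "N #>\<^bsub>A\<^esub> a" "\<one>\<^bsub>A Mod N\<^esub>"] j.hom_one j.G.one_closed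
      by (simp add: Group.iso_iff)
    also have "\<dots> \<longleftrightarrow> N #>\<^bsub>A\<^esub> a = N" by (simp add: FactGroup_def)
    also have "\<dots> \<longleftrightarrow> a \<in> N"
      using a coset_join1[OF _ a subgroup_axioms] coset_join2[OF a subgroup_axioms] by blast
    finally show ?thesis .
  qed
  have "j \<circ> (\<lambda>a. N #>\<^bsub>A\<^esub> a) \<in> hom A T"
    using r_coset_hom_Mod j.homh by (rule Group.hom_compose)
  moreover have "kernel A T (j \<circ> (\<lambda>a. N #>\<^bsub>A\<^esub> a)) = N"
    using ker subset by (auto simp: kernel_def)
  ultimately show ?thesis using that T(1) by blast
qed

text \<open>The intersection is the kernel of the pair of homomorphisms into the direct
  product.\<close>

lemma open_normal_Int:
  assumes C: "group_class C" "closed_subgroups C" "closed_dirprod C" and A: "group A"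
    and M: "open_normal C A M" and N: "open_normal C A N"
  shows "open_normal C A (M \<inter> N)"
proof -
  obtain S \<phi> where S: "C S" "\<phi> \<in> hom A S" "kernel A S \<phi> = M" using open_normal_hom[OF C(1) A M] .
  obtain T \<psi> where T: "C T" "\<psi> \<in> hom A T" "kernel A T \<psi> = N" using open_normal_hom[OF C(1) A N] .
  have "in_cls C (S \<times>\<times> T)" using C S(1) T(1) by (intro in_cls_DirProd in_cls_self)
  moreover have "(\<lambda>a. (\<phi> a, \<psi> a)) \<in> hom A (S \<times>\<times> T)" using S T by (auto simp: hom_def DirProd_def)
  moreover have "kernel A (S \<times>\<times> T) (\<lambda>a. (\<phi> a, \<psi> a)) = M \<inter> N"
    using S(3) T(3) by (auto simp: kernel_def DirProd_def)
  ultimately show ?thesis using open_normal_kernel[OF C(1,2) A] by metis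
qed

lemma l_coset_mono: "M \<subseteq> N \<Longrightarrow> x <#\<^bsub>A\<^esub> M \<subseteq> x <#\<^bsub>A\<^esub> N"
  by (auto simp: l_coset_def)

text \<open>The definition of \<open>pro_top\<close> can be unfolded once the axioms of a topology
  are checked. Closure under direct products enters for binary intersections.\<close>

lemma openin_pro_top:
  assumes C: "group_class C" "closed_subgroups C" "closed_dirprod C" and A: "group A"
  shows "openin (pro_top C A) U \<longleftrightarrow>
    U \<subseteq> carrier A \<and> (\<forall>x\<in>U. \<exists>N. open_normal C A N \<and> x <#\<^bsub>A\<^esub> N \<subseteq> U)"
proof -
  let ?L = "\<lambda>U. U \<subseteq> carrier A \<and> (\<forall>x\<in>U. \<exists>N. open_normal C A N \<and> x <#\<^bsub>A\<^esub> N \<subseteq> U)"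
  have "istopology ?L"
    unfolding istopology_def
  proof (intro conjI allI impI)
    fix S T assume S: "?L S" and T: "?L T"
    show "S \<inter> T \<subseteq> carrier A" using S by blast
    show "\<forall>x\<in>S \<inter> T. \<exists>N. open_normal C A N \<and> x <#\<^bsub>A\<^esub> N \<subseteq> S \<inter> T"
    proof
      fix x assume "x \<in> S \<inter> T"
      then obtain M N where MN: "open_normal C A M" "x <#\<^bsub>A\<^esub> M \<subseteq> S"
        "open_normal C A N" "x <#\<^bsub>A\<^esub> N \<subseteq> T" using S T by blast
      have "x <#\<^bsub>A\<^esub> (M \<inter> N) \<subseteq> S \<inter> T"
        using MN(2,4) l_coset_mono[of "M \<inter> N" M A x] l_coset_mono[of "M \<inter> N" N A x] by blast
      then show "\<exists>N. open_normal C A N \<and> x <#\<^bsub>A\<^esub> N \<subseteq> S \<inter> T"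
        using open_normal_Int[OF C A MN(1,3)] by blast
    qed
  next
    fix K assume K: "\<forall>S\<in>K. ?L S"
    then show "\<Union>K \<subseteq> carrier A" by blast
    show "\<forall>x\<in>\<Union>K. \<exists>N. open_normal C A N \<and> x <#\<^bsub>A\<^esub> N \<subseteq> \<Union>K"
      using K by (meson UnionE Union_upper order_trans)
  qed
  then show ?thesis unfolding pro_top_def open_normal_def conj_assoc by (subst topology_inverse') simp_all
qed

text \<open>The trivial homomorphism into a member \<open>T\<close> of the class shows that
  \<open>A\<close> is an open normal subgroup of itself.\<close>

lemma topspace_pro_top:
  assumes C: "group_class C" "closed_subgroups C" "closed_dirprod C" and A: "group A" and T: "C T"
  shows "topspace (pro_top C A) = carrier A"
proof
  show "topspace (pro_top C A) \<subseteq> carrier A"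
    unfolding topspace_def using openin_pro_top[OF C A] by blast
  interpret group A by fact
  have "(\<lambda>_. \<one>\<^bsub>T\<^esub>) \<in> hom A T" using trivial_hom group_classD[OF C(1) T] by blast
  then have "open_normal C A (kernel A T (\<lambda>_. \<one>\<^bsub>T\<^esub>))"
    using C T A by (intro open_normal_kernel in_cls_self)
  moreover have "kernel A T (\<lambda>_. \<one>\<^bsub>T\<^esub>) = carrier A" by (auto simp: kernel_def)
  moreover have "x <#\<^bsub>A\<^esub> carrier A \<subseteq> carrier A" if "x \<in> carrier A" for x
    using that by (auto simp: l_coset_def)
  ultimately have "openin (pro_top C A) (carrier A)"
    unfolding openin_pro_top[OF C A] by (metis order_refl)
  then show "carrier A \<subseteq> topspace (pro_top C A)" by (rule openin_subset)
qed

lemma closedin_pro_top_subgroup: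
  assumes C: "group_class C" "closed_subgroups C" "closed_dirprod C" and A: "group A" and T: "C T"
    and H: "subgroup H A"
  shows "closedin (pro_top C A) H \<longleftrightarrow>
    (\<forall>a\<in>carrier A - H. \<exists>N. open_normal C A N \<and> (a <#\<^bsub>A\<^esub> N) \<inter> H = {})"
proof -
  interpret group A by fact
  have "a <#\<^bsub>A\<^esub> N \<subseteq> carrier A" if "a \<in> carrier A" "open_normal C A N" for a N
    using that normal_imp_subgroup subgroup.subset l_coset_subset_G unfolding open_normal_def by metis
  then have "a <#\<^bsub>A\<^esub> N \<subseteq> carrier A - H \<longleftrightarrow> (a <#\<^bsub>A\<^esub> N) \<inter> H = {}"
    if "a \<in> carrier A" "open_normal C A N" for a N
    using that by blast
  then have "(\<exists>N. open_normal C A N \<and> a <#\<^bsub>A\<^esub> N \<subseteq> carrier A - H) \<longleftrightarrow>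
      (\<exists>N. open_normal C A N \<and> (a <#\<^bsub>A\<^esub> N) \<inter> H = {})" if "a \<in> carrier A" for a
    using that by blast
  then show ?thesis
    unfolding closedin_def topspace_pro_top[OF C A T] openin_pro_top[OF C A]
    using subgroup.subset[OF H] by simp
qed

text \<open>A single quotient has to keep all syllables of a word outside the image of
  \<open>H\<close>; finitely many open normal subgroups are intersected for this.\<close>

lemma open_normal_avoid:
  assumes C: "group_class C" "closed_subgroups C" "closed_dirprod C" and A: "group A" and T: "C T"
    and cl: "\<And>a. a \<in> carrier A - H \<Longrightarrow> \<exists>N. open_normal C A N \<and> (a <#\<^bsub>A\<^esub> N) \<inter> H = {}"
    and "finite B" "B \<subseteq> carrier A - H"
  shows "\<exists>N. open_normal C A N \<and> (\<forall>a\<in>B. (a <#\<^bsub>A\<^esub> N) \<inter> H = {})"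
  using assms(7,8)
proof induction
  case empty
  have "(\<lambda>_. \<one>\<^bsub>T\<^esub>) \<in> hom A T" using trivial_hom group_classD[OF C(1) T] by blast
  then have "open_normal C A (kernel A T (\<lambda>_. \<one>\<^bsub>T\<^esub>))"
    using C T A by (intro open_normal_kernel in_cls_self)
  then show ?case by blast
next
  case (insert a B)
  then obtain N where N: "open_normal C A N" "\<forall>b\<in>B. (b <#\<^bsub>A\<^esub> N) \<inter> H = {}" by auto
  obtain M where M: "open_normal C A M" "(a <#\<^bsub>A\<^esub> M) \<inter> H = {}" using cl[of a] insert.prems by blast
  have "(b <#\<^bsub>A\<^esub> (M \<inter> N)) \<inter> H = {}" if "b \<in> insert a B" for b
    using that M(2) N(2) l_coset_mono[of "M \<inter> N" M A b] l_coset_mono[of "M \<inter> N" N A b] by blast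
  then show ?case using open_normal_Int[OF C A M(1) N(1)] by blast
qed

section \<open>Separating alternating words of the double in a wreath product\<close>

lemma mprod_take_Suc:
  assumes "group G" "set xs \<subseteq> carrier G" "j < length xs"
  shows "mprod G (take (Suc j) xs) = mprod G (take j xs) \<otimes>\<^bsub>G\<^esub> xs ! j"
proof -
  interpret group G by fact
  have "xs ! j \<in> carrier G" using assms(2,3) nth_mem by blast
  moreover have "set (take j xs) \<subseteq> carrier G" using assms(2) set_take_subset by fast
  ultimately have "mprod G (take j xs @ [xs ! j]) = mprod G (take j xs) \<otimes>\<^bsub>G\<^esub> mprod G [xs ! j]"
    by (intro mprod_append) auto
  then show ?thesis using assms(3) \<open>xs ! j \<in> carrier G\<close> by (simp add: take_Suc_conv_app_nth)
qed

text \<open>The syllables of the second copy contribute \<open>f(p)\<inverse> f(q)\<close> for consecutive prefixes \<open>p, q\<close>. As the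
copies alternate, the base coordinate at \<open>\<one>\<close> is a reduced word in the cosets of the prefixes, up to its
first and last letter.\<close>
lemma double_word_separates:
  fixes A :: "('a, 'm) monoid_scheme" and R :: "'c monoid \<Rightarrow> bool" and T :: "'c monoid"
  assumes D: "is_double A H G i1 i2" and A: "group A" and H: "subgroup H A"
    and R: "root_class R" and T: "group T" "\<phi> \<in> hom A T"
    and l: "set l \<subseteq> carrier A \<times> UNIV" "length l \<ge> 2"
    and alt: "\<And>j. Suc j < length l \<Longrightarrow> snd (l ! j) \<noteq> snd (l ! Suc j)"
    and out: "\<And>j. j < length l \<Longrightarrow> \<phi> (fst (l ! j)) \<notin> \<phi> ` H"
  obtains U \<psi> where "R U" "\<psi> \<in> hom G (wreath U T)" "\<psi> (mprod G (map (letter i1 i2) l)) \<noteq> \<one>\<^bsub>wreath U T\<^esub>"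
    "\<psi> ` carrier G \<lesssim> (UNIV :: 'c set)"
proof -
  have D': "group G" "i1 \<in> hom A G" "i2 \<in> hom A G"
    "generate G (i1 ` carrier A \<union> i2 ` carrier A) = carrier G"
    using D by (auto simp: is_double_def)
  interpret A: group A by fact
  interpret i1: group_hom A G i1 using A D' by (simp add: group_hom_def group_hom_axioms_def)
  interpret i2: group_hom A G i2 using A D' by (simp add: group_hom_def group_hom_axioms_def)
  interpret phi: group_hom A T \<phi> using A T by (simp add: group_hom_def group_hom_axioms_def)
  define K where "K = \<phi> ` H"
  have K: "subgroup K T" unfolding K_def using H by (rule phi.subgroup_img_is_subgroup)
  let ?n = "length l"
  let ?ls = "map (letter i1 i2) l"
  define c where "c = (\<lambda>j. \<phi> (fst (l ! j)))"
  define p where "p = (\<lambda>j. mprod T (take j (map (\<phi> \<circ> fst) l)))"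
  have fl: "fst (l ! j) \<in> carrier A" if "j < ?n" for j
    using nth_mem[OF that] l(1) by auto
  have c: "c j \<in> carrier T" "c j \<notin> K" if "j < ?n" for j
    using that fl out by (auto simp: c_def K_def)
  have sl: "set (map (\<phi> \<circ> fst) l) \<subseteq> carrier T" using l(1) by auto
  have p: "p j \<in> carrier T" for j
    unfolding p_def using sl set_take_subset by (intro phi.H.mprod_closed) fast
  have pS: "p (Suc j) = p j \<otimes>\<^bsub>T\<^esub> c j" if "j < ?n" for j
    using that mprod_take_Suc[OF T(1) sl] by (simp add: p_def c_def)
  have p0: "p 0 = \<one>\<^bsub>T\<^esub>" by (simp add: p_def)
  \<comment> \<open>The labels of the auxiliary word are the left cosets of the prefixes.
    Neighbouring ones differ because no syllable is mapped into \<open>K\<close>.\<close>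
  define z where "z = (\<lambda>j. p j <#\<^bsub>T\<^esub> K)"
  have zS: "z j \<noteq> z (Suc j)" if j: "j < ?n" for j
  proof
    assume "z j = z (Suc j)"
    moreover have "p (Suc j) \<in> z (Suc j)"
      using p[of "Suc j"] subgroup.one_closed[OF K] by (force simp: z_def l_coset_def)
    ultimately obtain k where k: "k \<in> K" "p j \<otimes>\<^bsub>T\<^esub> c j = p j \<otimes>\<^bsub>T\<^esub> k"
      using pS[OF j] by (auto simp: z_def l_coset_def)
    then have "c j = k" using c(1)[OF j] p[of j] subgroup.mem_carrier[OF K] by simp
    then show False using k(1) c(2)[OF j] by simp
  qed
  \<comment> \<open>The alternating pattern of copies is continued beyond the end of
    \<open>l\<close>, since the auxiliary word has one letter more than \<open>l\<close>.\<close>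
  define b where "b = (\<lambda>j::nat. if even j then snd (l ! 0) else \<not> snd (l ! 0))"
  have b: "b j = snd (l ! j)" if "j < ?n" for j
    using that
  proof (induction j)
    case (Suc j)
    then show ?case using alt[of j] by (auto simp: b_def split: if_splits)
  qed (simp add: b_def)
  have bS: "b (Suc j) = (\<not> b j)" for j by (simp add: b_def)
  \<comment> \<open>With these signs, a syllable of the second copy at position \<open>j\<close>
    contributes the letters \<open>j\<close> and \<open>Suc j\<close> of the auxiliary word, the
    first one inverted. The word is reduced because neighbouring labels differ.\<close>
  obtain U f where U: "R U" "\<And>x. f x \<in> carrier U" "inj_on (upath U f z (\<lambda>j. \<not> b j)) {..Suc ?n}"
    using root_class_separates[OF R, of "Suc ?n" z "\<lambda>j. \<not> b j"] zS by auto
  let ?v = "upath U f z (\<lambda>j. \<not> b j)"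
  define F where "F = (\<lambda>x. f (x <#\<^bsub>T\<^esub> K))"
  have gU: "group U" using R U(1) by (auto simp only: root_class_def dest: group_classD)
  interpret wreath_groups U T using gU T(1) by (simp add: wreath_groups_def)
  have F: "F x \<in> carrier U" for x using U(2) by (simp add: F_def)
  have FK: "F (x \<otimes>\<^bsub>T\<^esub> \<phi> h) = F x" if "x \<in> carrier T" "h \<in> H" for x h
  proof -
    have "\<phi> h \<in> K" using that(2) by (simp add: K_def)
    then have "\<phi> h <#\<^bsub>T\<^esub> K = K"
      using phi.H.coset_join3[OF subgroup.mem_carrier[OF K] K] by simp
    moreover have "x \<otimes>\<^bsub>T\<^esub> \<phi> h <#\<^bsub>T\<^esub> K = x <#\<^bsub>T\<^esub> (\<phi> h <#\<^bsub>T\<^esub> K)"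
      using phi.H.lcos_m_assoc[OF subgroup.subset[OF K] that(1) subgroup.mem_carrier[OF K \<open>\<phi> h \<in> K\<close>]]
      by simp
    ultimately show ?thesis by (simp add: F_def)
  qed
  obtain \<psi> where psi: "\<psi> \<in> hom G W"
    "\<And>a. a \<in> carrier A \<Longrightarrow> \<psi> (i1 a) = (\<lambda>x\<in>carrier T. \<one>\<^bsub>U\<^esub>, \<phi> a)"
    "\<And>a. a \<in> carrier A \<Longrightarrow> \<psi> (i2 a) = (\<lambda>x\<in>carrier T. inv\<^bsub>U\<^esub> F x \<otimes>\<^bsub>U\<^esub> F (x \<otimes>\<^bsub>T\<^esub> \<phi> a), \<phi> a)"
    using wreath_double_hom[OF D A T subgroup.subset[OF H] gU F FK] by blast
  interpret psi: group_hom G W \<psi>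
    using psi D' by (simp add: group_hom_def group_hom_axioms_def W.is_group)
  have lG: "set ?ls \<subseteq> carrier G" using l(1) by (auto simp: letter_def)
  define w where "w = (\<lambda>j. \<psi> (mprod G (take j ?ls)))"
  have wc: "w j \<in> carrier W" for j
  proof -
    have "mprod G (take j ?ls) \<in> carrier G"
      using lG set_take_subset[of j ?ls] by (intro i1.H.mprod_closed) (rule order_trans)
    then show ?thesis by (simp add: w_def)
  qed
  have lj: "letter i1 i2 (l ! j) \<in> carrier G" if "j < ?n" for j
    using lG that by auto
  have wS: "w (Suc j) = w j \<otimes>\<^bsub>W\<^esub> \<psi> (letter i1 i2 (l ! j))" if j: "j < ?n" for j
  proof -
    have "mprod G (take j ?ls) \<in> carrier G"
      using lG set_take_subset[of j ?ls] by (intro i1.H.mprod_closed) (rule order_trans)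
    then show ?thesis
      using mprod_take_Suc[OF D'(1) lG, of j] j lj[OF j] by (simp add: w_def)
  qed
  have sl: "snd (\<psi> (letter i1 i2 (l ! j))) = c j" if "j < ?n" for j
    using psi(2,3) fl[OF that] by (simp add: letter_def c_def)
  have fs: "fst (\<psi> (letter i1 i2 (l ! j))) x = (if b j then inv\<^bsub>U\<^esub> F x \<otimes>\<^bsub>U\<^esub> F (x \<otimes>\<^bsub>T\<^esub> c j) else \<one>\<^bsub>U\<^esub>)"
    if "j < ?n" "x \<in> carrier T" for j x
    using psi(2,3) fl[OF that(1)] that b by (simp add: letter_def c_def)
  have w0: "w 0 = \<one>\<^bsub>W\<^esub>" by (simp add: w_def)
  have sw: "snd (w j) = p j" if "j \<le> ?n" for j
    using that
  proof (induction j)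
    case 0
    then show ?case by (simp add: w0 one_wreath p0)
  next
    case (Suc j)
    then show ?case by (simp add: wS snd_mult_wreath sl pS)
  qed
  define V where "V = (\<lambda>j. fst (w j) \<one>\<^bsub>T\<^esub>)"
  have V: "V j \<in> carrier U" for j using fst_closed[OF wc] by (simp add: V_def)
  have VS: "V (Suc j) = V j \<otimes>\<^bsub>U\<^esub> (if b j then inv\<^bsub>U\<^esub> f (z j) \<otimes>\<^bsub>U\<^esub> f (z (Suc j)) else \<one>\<^bsub>U\<^esub>)"
    if "j < ?n" for j
    using that p[of j] by (simp add: V_def wS fst_mult_wreath sw fs F_def z_def pS)
  have vS: "?v (Suc j) = ?v j \<otimes>\<^bsub>U\<^esub> (if \<not> b j then f (z j) else inv\<^bsub>U\<^esub> f (z j))" for j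
    using U(2) by (rule U.upath_Suc)
  have v: "?v j \<in> carrier U" for j using U(2) by simp
  \<comment> \<open>If \<open>l\<close> begins in the first copy, the letter at position 0 is not
    contributed by any syllable and has to be skipped. The end index in \<open>key\<close> is
    adjusted likewise for the last letter.\<close>
  define lo where "lo = (if b 0 then 0 else Suc 0)"
  have key: "?v lo \<otimes>\<^bsub>U\<^esub> V j = ?v (if b j then j else Suc j)" if "j \<le> ?n" for j
    using that
  proof (induction j)
    case 0
    have "V 0 = \<one>\<^bsub>U\<^esub>" by (simp add: V_def w0 one_wreath)
    then show ?case using v[of lo] by (simp add: lo_def)
  next
    case (Suc j)
    then have IH: "?v lo \<otimes>\<^bsub>U\<^esub> V j = ?v (if b j then j else Suc j)" and j: "j < ?n" by simp_all
    show ?case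
    proof (cases "b j")
      case True
      have "?v lo \<otimes>\<^bsub>U\<^esub> V (Suc j) = ?v lo \<otimes>\<^bsub>U\<^esub> V j \<otimes>\<^bsub>U\<^esub> inv\<^bsub>U\<^esub> f (z j) \<otimes>\<^bsub>U\<^esub> f (z (Suc j))"
        using VS[OF j] True v V U(2) by (simp add: U.m_assoc)
      also have "\<dots> = ?v (Suc j) \<otimes>\<^bsub>U\<^esub> f (z (Suc j))" using IH vS[of j] True by simp
      also have "\<dots> = ?v (Suc (Suc j))" using vS[of "Suc j"] True bS by simp
      finally show ?thesis using True bS by simp
    next
      case False
      then show ?thesis using VS[OF j] IH V bS by simp
    qed
  qed
  have "V ?n \<noteq> \<one>\<^bsub>U\<^esub>"
  proof
    assume "V ?n = \<one>\<^bsub>U\<^esub>"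
    then have "?v lo = ?v (if b ?n then ?n else Suc ?n)" using key[of ?n] v by simp
    moreover have "lo \<le> 1" by (simp add: lo_def)
    ultimately have "lo = (if b ?n then ?n else Suc ?n)"
      using l(2) by (intro inj_onD[OF U(3)]) auto
    then show False using \<open>lo \<le> 1\<close> l(2) by (simp split: if_splits)
  qed
  then have "w ?n \<noteq> \<one>\<^bsub>W\<^esub>" by (auto simp: V_def one_wreath)
  then have neq: "\<psi> (mprod G ?ls) \<noteq> \<one>\<^bsub>W\<^esub>" by (simp add: w_def)
  \<comment> \<open>The image of a generator is determined by its copy and its top part, so two
    families indexed by \<open>'c\<close> cover all of them, and the generated image stays
    small.\<close>
  let ?g1 = "\<lambda>t :: 'c. (\<lambda>x\<in>carrier T. \<one>\<^bsub>U\<^esub>, t)"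
  let ?g2 = "\<lambda>t. (\<lambda>x\<in>carrier T. inv\<^bsub>U\<^esub> F x \<otimes>\<^bsub>U\<^esub> F (x \<otimes>\<^bsub>T\<^esub> t), t)"
  let ?Y = "i1 ` carrier A \<union> i2 ` carrier A"
  have YG: "?Y \<subseteq> carrier G" by auto
  have sub: "\<psi> ` ?Y \<subseteq> range ?g1 \<union> range ?g2"
    using psi(2,3) by auto
  have "range ?g1 \<lesssim> (UNIV :: 'c set)" "range ?g2 \<lesssim> (UNIV :: 'c set)"
    by (simp_all only: image_lepoll)
  then have "range ?g1 \<union> range ?g2 \<lesssim> (UNIV :: 'c set)"
    using root_class_infinite[OF R] by (intro Un_lepoll_UNIV)
  then have "\<psi> ` ?Y \<lesssim> (UNIV :: 'c set)" by (rule lepoll_trans[OF subset_imp_lepoll[OF sub]])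
  then have "generate W (\<psi> ` ?Y) \<lesssim> (UNIV :: 'c set)"
    using YG root_class_infinite[OF R] by (intro W.generate_lepoll) auto
  then have "\<psi> ` carrier G \<lesssim> (UNIV :: 'c set)"
    using psi.generate_img[OF YG] D'(4) by simp
  then show ?thesis using that U(1) psi(1) neq by blast
qed

section \<open>The folding map and the two directions of the equivalence\<close>

lemma double_fold:
  fixes A :: "('a, 'm) monoid_scheme"
  assumes "is_double A H G i1 i2" "group A"
  obtains \<pi> where "\<pi> \<in> hom G A" "\<And>a. a \<in> carrier A \<Longrightarrow> \<pi> (i1 a) = a"
    "\<And>a. a \<in> carrier A \<Longrightarrow> \<pi> (i2 a) = a"
  using double_hom[OF assms assms(2) iso_imp_homomorphism[OF iso_set_refl] iso_imp_homomorphism[OF iso_set_refl] refl]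
  by blast

text \<open>This is \<open>wreath_double_hom\<close> for the identity of \<open>A\<close> and a
  two-valued function that distinguishes \<open>H\<close> from its complement. At the identity the
  base coordinate of the image of \<open>i2 a\<close> is then \<open>m\<close>, that of
  \<open>i1 a\<close> is trivial.\<close>

lemma double_copies_differ:
  fixes A :: "('a, 'm) monoid_scheme" and M :: "('b, 'n) monoid_scheme"
  assumes D: "is_double A H G i1 i2" and A: "group A" and H: "subgroup H A"
    and M: "group M" "m \<in> carrier M" "m \<noteq> \<one>\<^bsub>M\<^esub>" and a: "a \<in> carrier A - H"
  shows "i1 a \<noteq> i2 a"
proof
  assume eq: "i1 a = i2 a"
  interpret A: group A by fact
  interpret M: group M by fact
  interpret H: subgroup H A by fact
  define f where "f = (\<lambda>x. if x \<in> H then \<one>\<^bsub>M\<^esub> else m)"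
  have f: "f x \<in> carrier M" for x using M(2) by (simp add: f_def)
  have fH: "f (x \<otimes>\<^bsub>A\<^esub> h) = f x" if x: "x \<in> carrier A" and h: "h \<in> H" for x h
  proof -
    have "x \<in> H" if "x \<otimes>\<^bsub>A\<^esub> h \<in> H"
    proof -
      have "x \<otimes>\<^bsub>A\<^esub> h \<otimes>\<^bsub>A\<^esub> inv\<^bsub>A\<^esub> h \<in> H"
        using H.m_closed[OF that H.m_inv_closed[OF h]] .
      then show ?thesis using x H.mem_carrier[OF h] by (simp add: A.m_assoc)
    qed
    then show ?thesis using h by (auto simp: f_def)
  qed
  have id: "(\<lambda>x. x) \<in> hom A A" by (rule iso_imp_homomorphism[OF iso_set_refl])
  obtain \<psi> where psi: "\<psi> \<in> hom G (wreath M A)"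
    "\<And>a. a \<in> carrier A \<Longrightarrow> \<psi> (i1 a) = (\<lambda>x\<in>carrier A. \<one>\<^bsub>M\<^esub>, a)"
    "\<And>a. a \<in> carrier A \<Longrightarrow> \<psi> (i2 a) = (\<lambda>x\<in>carrier A. inv\<^bsub>M\<^esub> f x \<otimes>\<^bsub>M\<^esub> f (x \<otimes>\<^bsub>A\<^esub> a), a)"
    by (rule wreath_double_hom[OF D A A id H.subset M(1), of f]) (use f fH in auto)
  have "fst (\<psi> (i1 a)) \<one>\<^bsub>A\<^esub> = fst (\<psi> (i2 a)) \<one>\<^bsub>A\<^esub>" using eq by simp
  then have "\<one>\<^bsub>M\<^esub> = m"
    using psi(2,3)[of a] a M(2) by (simp add: f_def)
  then show False using M(3) by simp
qed

lemma residually_inj: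
  fixes C :: "'c monoid \<Rightarrow> bool"
  assumes "group_class C" "closed_subgroups C" "group A" "group G" "residually C G"
    and h: "h \<in> hom A G" "inj_on h (carrier A)"
  shows "residually C A"
  unfolding residually_iff[OF assms(1-3)]
proof (intro ballI impI)
  interpret h: group_hom A G h using assms by (simp add: group_hom_def group_hom_axioms_def)
  fix a assume a: "a \<in> carrier A" "a \<noteq> \<one>\<^bsub>A\<^esub>"
  then have "h a \<noteq> \<one>\<^bsub>G\<^esub>" using h(2) h.hom_one by (metis h.G.one_closed inj_onD)
  then obtain T :: "'c monoid" and \<phi> where T: "C T" "\<phi> \<in> hom G T" "\<phi> (h a) \<noteq> \<one>\<^bsub>T\<^esub>"
    using assms(5) h.hom_closed[OF a(1)] unfolding residually_iff[OF assms(1,2,4)] by blast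
  have "\<phi> \<circ> h \<in> hom A T" using h(1) T(2) by (rule Group.hom_compose)
  moreover have "(\<phi> \<circ> h) a \<noteq> \<one>\<^bsub>T\<^esub>" using T(3) by simp
  ultimately show "\<exists>(T::'c monoid) \<phi>. C T \<and> \<phi> \<in> hom A T \<and> \<phi> a \<noteq> \<one>\<^bsub>T\<^esub>" using T(1) by blast
qed

text \<open>Let \<open>N\<close> be the common kernel on both copies of a homomorphism that
  separates \<open>i1 a\<close> from \<open>i2 a\<close>. An element of \<open>H\<close> in the
  coset of \<open>a\<close> has the same image through both copies, which would make the images of
  \<open>i1 a\<close> and \<open>i2 a\<close> equal.\<close>

lemma residually_double_open_normal:
  fixes C :: "'c monoid \<Rightarrow> bool" and A :: "('a, 'm) monoid_scheme"
  assumes C: "group_class C" "closed_subgroups C" "closed_dirprod C"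
    and D: "is_double A H G i1 i2" and A: "group A" and res: "residually C G"
    and a: "a \<in> carrier A" "i1 a \<noteq> i2 a"
  shows "\<exists>N. open_normal C A N \<and> (a <#\<^bsub>A\<^esub> N) \<inter> H = {}"
proof -
  have D': "group G" "i1 \<in> hom A G" "i2 \<in> hom A G" "\<And>h. h \<in> H \<Longrightarrow> i1 h = i2 h"
    using D by (auto simp: is_double_def)
  interpret A: group A by fact
  interpret G: group G by fact
  interpret i1: group_hom A G i1 using A D' by (simp add: group_hom_def group_hom_axioms_def)
  interpret i2: group_hom A G i2 using A D' by (simp add: group_hom_def group_hom_axioms_def)
  have ia: "i1 a \<in> carrier G" "i2 a \<in> carrier G" using a(1) by simp_all
  let ?g = "i1 a \<otimes>\<^bsub>G\<^esub> inv\<^bsub>G\<^esub> i2 a"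
  have "?g \<noteq> \<one>\<^bsub>G\<^esub>" using a(2) ia G.inv_equality[of "i1 a" "inv\<^bsub>G\<^esub> i2 a"] by auto
  then obtain T :: "'c monoid" and \<phi> where T: "C T" "\<phi> \<in> hom G T" "\<phi> ?g \<noteq> \<one>\<^bsub>T\<^esub>"
    using res ia unfolding residually_iff[OF C(1,2) D'(1)] by (meson G.inv_closed G.m_closed)
  have gT: "group T" using C(1) T(1) by (rule group_classD)
  interpret phi: group_hom G T \<phi> using T gT by (simp add: group_hom_def group_hom_axioms_def)
  have neq: "\<phi> (i1 a) \<noteq> \<phi> (i2 a)" using T(3) ia by auto
  let ?h = "\<lambda>a. (\<phi> (i1 a), \<phi> (i2 a))"
  let ?N = "kernel A (T \<times>\<times> T) ?h"
  have "?h \<in> hom A (T \<times>\<times> T)" by (auto simp: hom_def DirProd_def)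
  then have "open_normal C A ?N"
    using C T(1) A by (intro open_normal_kernel in_cls_DirProd in_cls_self)
  moreover have "(a <#\<^bsub>A\<^esub> ?N) \<inter> H = {}"
  proof (rule ccontr)
    assume "(a <#\<^bsub>A\<^esub> ?N) \<inter> H \<noteq> {}"
    then obtain n where n: "n \<in> carrier A" "\<phi> (i1 n) = \<one>\<^bsub>T\<^esub>" "\<phi> (i2 n) = \<one>\<^bsub>T\<^esub>" "a \<otimes>\<^bsub>A\<^esub> n \<in> H"
      by (auto simp: l_coset_def kernel_def DirProd_def)
    have "\<phi> (i1 (a \<otimes>\<^bsub>A\<^esub> n)) = \<phi> (i2 (a \<otimes>\<^bsub>A\<^esub> n))" using D'(4)[OF n(4)] by simp
    then show False using neq n(1-3) a(1) ia by simp
  qed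
  ultimately show ?thesis by blast
qed

theorem theorem1p9:
  fixes A :: "'a monoid" and H :: "'a set"
    and G :: "'g monoid" and i1 i2 :: "'a \<Rightarrow> 'g"
    and C R :: "'c monoid \<Rightarrow> bool"
  assumes "group A" and "subgroup H A"
    and "is_double A H G i1 i2"
    and "group_class C" and "root_class R" and "\<forall>Gx. R Gx \<longrightarrow> C Gx"
    and "closed_subgroups C" and "closed_dirprod C"
    and "closed_ext R C"
    and "\<forall>Gx. C Gx \<longrightarrow> (\<exists>Gy. R Gy \<and> (\<exists>f. bij_betw f (carrier Gx) (carrier Gy)))"
  shows "residually C G \<longleftrightarrow> residually C A \<and> closedin (pro_top C A) H"
proof -
  note A = assms(1) and H = assms(2) and D = assms(3) and C = assms(4,7,8)
  interpret A: group A by fact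
  have D': "group G" "i1 \<in> hom A G" "i2 \<in> hom A G" using D by (auto simp: is_double_def)
  have R': "group_class R" using assms(5) by (simp add: root_class_def)
  obtain M where M: "R M" "carrier M \<noteq> {\<one>\<^bsub>M\<^esub>}" using assms(5) by (auto simp: root_class_def)
  have gM: "group M" using R' M(1) by (rule group_classD)
  then have "\<one>\<^bsub>M\<^esub> \<in> carrier M" by (simp add: group.is_monoid monoid.one_closed)
  then obtain m where m: "m \<in> carrier M" "m \<noteq> \<one>\<^bsub>M\<^esub>" using M(2) by blast
  have CM: "C M" using M(1) assms(6) by blast
  obtain \<pi> where pi: "\<pi> \<in> hom G A" "\<And>a. a \<in> carrier A \<Longrightarrow> \<pi> (i1 a) = a"
    "\<And>a. a \<in> carrier A \<Longrightarrow> \<pi> (i2 a) = a"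
    using double_fold[OF D A] by blast
  interpret pi: group_hom G A \<pi> using A D' pi by (simp add: group_hom_def group_hom_axioms_def)
  show ?thesis
  proof
    assume res: "residually C G"
    have "inj_on i1 (carrier A)" using pi(2) by (metis inj_onI)
    then have "residually C A" using residually_inj[OF C(1,2) A D'(1) res D'(2)] by blast
    moreover have "closedin (pro_top C A) H"
      unfolding closedin_pro_top_subgroup[OF C A CM H]
    proof
      fix a assume a: "a \<in> carrier A - H"
      have "i1 a \<noteq> i2 a" using double_copies_differ[OF D A H gM m a] .
      then show "\<exists>N. open_normal C A N \<and> (a <#\<^bsub>A\<^esub> N) \<inter> H = {}"
        using residually_double_open_normal[OF C D A res] a by blast
    qed
    ultimately show "residually C A \<and> closedin (pro_top C A) H" ..
  next
    assume res: "residually C A \<and> closedin (pro_top C A) H"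
    show "residually C G"
      unfolding residually_iff[OF C(1,2) D'(1)]
    proof (intro ballI impI)
      fix g assume g: "g \<in> carrier G" "g \<noteq> \<one>\<^bsub>G\<^esub>"
      show "\<exists>(T::'c monoid) \<phi>. C T \<and> \<phi> \<in> hom G T \<and> \<phi> g \<noteq> \<one>\<^bsub>T\<^esub>"
      proof (cases "\<pi> g = \<one>\<^bsub>A\<^esub>")
        case False
        then obtain T :: "'c monoid" and \<phi> where T: "C T" "\<phi> \<in> hom A T" "\<phi> (\<pi> g) \<noteq> \<one>\<^bsub>T\<^esub>"
          using res pi.hom_closed[OF g(1)] unfolding residually_iff[OF C(1,2) A] by blast
        have "\<phi> \<circ> \<pi> \<in> hom G T" using pi(1) T(2) by (rule Group.hom_compose)
        moreover have "(\<phi> \<circ> \<pi>) g \<noteq> \<one>\<^bsub>T\<^esub>" using T(3) by simp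
        ultimately show ?thesis using T(1) by blast
      next
        case True
        obtain l where l: "set l \<subseteq> carrier A \<times> UNIV" "g = mprod G (map (letter i1 i2) l)"
          "\<And>j. Suc j < length l \<Longrightarrow>
            fst (l ! j) \<notin> H \<and> fst (l ! Suc j) \<notin> H \<and> snd (l ! j) \<noteq> snd (l ! Suc j)"
          using double_normal_form[OF D A H g(1)] by blast
        \<comment> \<open>The folding map returns the entry of a single syllable, so a nontrivial
          element of its kernel needs at least two.\<close>
        have len: "length l \<ge> 2"
        proof (rule ccontr)
          assume "\<not> 2 \<le> length l"
          then consider "l = []" | a x where "l = [(a, x)]"
            by (cases l) (auto simp: Suc_le_eq)
          then show False
          proof cases
            case 1
            then show False using l(2) g(2) by simp
          next
            case (2 a x)
            have a: "a \<in> carrier A" using l(1) 2 by simp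
            interpret i1: group_hom A G i1 using A D' by (simp add: group_hom_def group_hom_axioms_def)
            interpret i2: group_hom A G i2 using A D' by (simp add: group_hom_def group_hom_axioms_def)
            have ga: "g = (if x then i2 a else i1 a)" using l(2) 2 a by (simp add: letter_def)
            then have "a = \<one>\<^bsub>A\<^esub>" using True pi(2,3) a by (simp split: if_splits)
            then show False using ga g(2) by (cases x) simp_all
          qed
        qed
        have out: "fst (l ! j) \<in> carrier A - H" if j: "j < length l" for j
        proof -
          have "l ! j \<in> carrier A \<times> UNIV" using l(1) nth_mem[OF j] by blast
          \<comment> \<open>Every syllable now has a neighbour; the last one is reached through the
            pair that begins at its predecessor.\<close>
          moreover have "fst (l ! j) \<notin> H" using l(3)[of j] l(3)[of "j - 1"] j len by (cases j) auto
          ultimately show ?thesis by auto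
        qed
        have cl: "\<exists>N. open_normal C A N \<and> (a <#\<^bsub>A\<^esub> N) \<inter> H = {}" if "a \<in> carrier A - H" for a
          using res that unfolding closedin_pro_top_subgroup[OF C A CM H] by blast
        have "fst ` set l \<subseteq> carrier A - H"
          using out by (metis image_subsetI in_set_conv_nth)
        then obtain N where N: "open_normal C A N" "\<forall>a\<in>fst ` set l. (a <#\<^bsub>A\<^esub> N) \<inter> H = {}"
          using open_normal_avoid[OF C A CM cl, where B = "fst ` set l"] by auto
        obtain T :: "'c monoid" and \<phi> where T: "C T" "\<phi> \<in> hom A T" "kernel A T \<phi> = N"
          using open_normal_hom[OF C(1) A N(1)] by blast
        have gT: "group T" using C(1) T(1) by (rule group_classD)
        interpret phi: group_hom A T \<phi> using A gT T(2) by (simp add: group_hom_def group_hom_axioms_def)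
        \<comment> \<open>If a syllable and some \<open>h\<close> in \<open>H\<close> had the same
          image, \<open>h\<close> would lie in the coset of the syllable modulo \<open>N\<close>,
          which avoids \<open>H\<close>.\<close>
        have sep: "\<phi> (fst (l ! j)) \<notin> \<phi> ` H" if j: "j < length l" for j
        proof
          let ?c = "fst (l ! j)"
          assume "\<phi> ?c \<in> \<phi> ` H"
          then obtain h where h: "h \<in> H" "\<phi> ?c = \<phi> h" by blast
          have c: "?c \<in> carrier A" "h \<in> carrier A" using out[OF j] subgroup.mem_carrier[OF H h(1)] by auto
          then have "inv\<^bsub>A\<^esub> ?c \<otimes>\<^bsub>A\<^esub> h \<in> N" using h(2) T(3) by (auto simp: kernel_def)
          then have "?c \<otimes>\<^bsub>A\<^esub> (inv\<^bsub>A\<^esub> ?c \<otimes>\<^bsub>A\<^esub> h) \<in> ?c <#\<^bsub>A\<^esub> N" by (auto simp: l_coset_def)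
          then have "h \<in> ?c <#\<^bsub>A\<^esub> N" using c A.m_assoc[of ?c "inv\<^bsub>A\<^esub> ?c" h] by simp
          then show False using N(2) h(1) nth_mem[OF j] by blast
        qed
        have alt: "snd (l ! j) \<noteq> snd (l ! Suc j)" if "Suc j < length l" for j
          using l(3)[OF that] by blast
        obtain U \<psi> where U: "R U" "\<psi> \<in> hom G (wreath U T)" "\<psi> g \<noteq> \<one>\<^bsub>wreath U T\<^esub>"
          "\<psi> ` carrier G \<lesssim> (UNIV :: 'c set)"
          using double_word_separates[OF D A H assms(5) gT T(2) l(1) len alt sep] unfolding l(2)[symmetric]
          by blast
        \<comment> \<open>The hypothesis on cardinalities supplies the group of \<open>R\<close>
          along which the base group is reindexed.\<close>
        obtain S f where S: "R S" "bij_betw f (carrier T) (carrier S)" using assms(10) T(1) by blast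
        interpret wreath_groups U T using gT group_classD[OF R' U(1)] by (simp add: wreath_groups_def)
        interpret psi: group_hom G W \<psi> using D'(1) U(2) by (simp add: group_hom_def group_hom_axioms_def W.is_group)
        let ?E = "W\<lparr>carrier := \<psi> ` carrier G\<rparr>"
        have "in_cls C ?E"
          by (rule wreath_subgroup_in_cls_ext[OF assms(5) C(1,2) assms(9) U(1) T(1) S psi.img_is_subgroup U(4)])
        then obtain Z k where Z: "C Z" "k \<in> iso ?E Z" by (rule in_cls_E)
        have "group ?E" using \<open>in_cls C ?E\<close> by (simp add: in_cls_def)
        then interpret k: group_hom ?E Z k
          using Z group_classD[OF C(1)] by (simp add: group_hom_def group_hom_axioms_def Group.iso_iff)
        have "\<psi> \<in> hom G ?E" using U(2) by (auto simp: hom_def)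
        then have "k \<circ> \<psi> \<in> hom G Z" using k.homh by (rule Group.hom_compose)
        moreover have "k (\<psi> g) \<noteq> \<one>\<^bsub>Z\<^esub>"
          using Z(2) U(3) g(1) k.hom_one k.G.one_closed inj_onD[of k "carrier ?E" "\<psi> g" "\<one>\<^bsub>W\<^esub>"]
          by (auto simp: Group.iso_iff)
        ultimately show ?thesis using Z(1) by (auto intro!: exI[of _ Z] exI[of _ "k \<circ> \<psi>"])
      qed
    qed
  qed
qed

end
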